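(* For any partially ordered group $G$ and any variety $\mathsf V$ of $\ell$-groups, the space $\mathscr{P}_{\mathsf V}(G)$ is a completely normal generalised spectral space whose specialisation order coincides with the inclusion order (of pre-cones).
   Context: A partially ordered group is a group $G$ (identity $\mathrm{e}$) with a partial order such that $a\le b$ implies $sat\le sbt$; $G^+=\{a\mid a\ge \mathrm{e}\}$. An $\ell$-group is a partially ordered group whose order is a lattice; an $\ell$-subgroup is a sublattice subgroup; a variety of $\ell$-groups is an equationally definable class. A right pre-order on $G$ is a reflexive, transitive, total relation $\preceq$ on $G$, with $\preceq\ne G\times G$, extending the partial order of $G$ and such that $a\preceq b\Rightarrow at\preceq bt$. It is identified with its pre-cone $C=\{a\mid \mathrm{e}\preceq a\}$; pre-cones are exactly the proper submonoids $C\subsetneq G$ with $G=C\cup C^{-1}$ and $G^+\subseteq C$, and $a\preceq_C b$ iff $ba^{-1}\in C$. Put $a\equiv_C b$ iff $a\preceq_C b$ and $b\preceq_C a$; $\Omega_C=G/{\equiv_C}$ is a chain with $[a]\le_C[b]$ iff $a\preceq_C b$. $\mathrm{Aut}\,\Omega_C$ is the $\ell$-group of order-preserving bijections of $\Omega_C$, where $f\cdot g$ means "$g$ after $f$" and lattice operations are pointwise. With $R_C(a)\colon[b]\mapsto[ba]$, $H_C$ is the $\ell$-subgroup of $\mathrm{Aut}\,\Omega_C$ generated by $R_C[G]$. $\mathscr{P}_{\mathsf V}(G)$ is the set of right pre-orders (pre-cones) $C$ on $G$ with $H_C\in\mathsf V$, with the smallest topology containing all sets $\mathbb{P}(a)=\{C\in\mathscr{P}_{\mathsf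 V}(G)\mid a\in C,\ a^{-1}\notin C\}$, $a\in G$. A topological space is sober if every nonempty irreducible closed set (one that is not the union of two proper closed subsets of itself) is the closure of a unique point. A generalised spectral space is a sober space whose compact open subsets form a base closed under finite (nonempty) intersections; no Hausdorff condition is part of "compact", and the whole space need not be compact. A generalised spectral space $X$ is completely normal if whenever $x,y$ lie in the closure of $\{z\}$, either $x$ is in the closure of $\{y\}$ or $y$ is in the closure of $\{x\}$. The specialisation order is: $x\preceq y$ iff $y$ is in the closure of $\{x\}$. *)

theory Defs
  imports "HOL-Analysis.Abstract_Topology" "HOL-Algebra.Lattice" "HOL-Algebra.Bij"
begin

(* It would clash with the topological closure. *)
no_notation eq_closure_of (\<open>closure'_of\<index>\<close>)

section \<open>Partially ordered groups and lattice-ordered groups\<close>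

record 'a pogroup = "'a monoid" +
  leq :: "['a, 'a] \<Rightarrow> bool" (infixl \<open>\<preceq>\<index>\<close> 50)

text \<open>The underlying ordered set, in the format of the order and lattice theory of HOL-Algebra.\<close>

definition order_reduct :: "('a, 'b) pogroup_scheme \<Rightarrow> 'a gorder"
  where "order_reduct G = \<lparr>carrier = carrier G, eq = (=), le = leq G\<rparr>"

locale po_group = group G for G (structure) +
  assumes order: "partial_order (order_reduct G)"
    and translate: "\<lbrakk>a \<in> carrier G; b \<in> carrier G; s \<in> carrier G; t \<in> carrier G; a \<preceq> b\<rbrakk>
      \<Longrightarrow> s \<otimes> a \<otimes> t \<preceq> s \<otimes> b \<otimes> t"

locale l_group = po_group +
  assumes lattice: "lattice (order_reduct G)"

abbreviation gjoin :: "('a, 'b) pogroup_scheme \<Rightarrow> 'a \<Rightarrow> 'a \<Rightarrow> 'a"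
  where "gjoin L \<equiv> join (order_reduct L)"

abbreviation gmeet :: "('a, 'b) pogroup_scheme \<Rightarrow> 'a \<Rightarrow> 'a \<Rightarrow> 'a"
  where "gmeet L \<equiv> meet (order_reduct L)"

definition l_subgroup :: "'a set \<Rightarrow> ('a, 'b) pogroup_scheme \<Rightarrow> bool"
  where "l_subgroup H L \<longleftrightarrow>
    subgroup H L \<and> (\<forall>x\<in>H. \<forall>y\<in>H. gjoin L x y \<in> H \<and> gmeet L x y \<in> H)"

definition l_generate :: "('a, 'b) pogroup_scheme \<Rightarrow> 'a set \<Rightarrow> 'a set"
  where "l_generate L S = \<Inter>{H. l_subgroup H L \<and> S \<subseteq> H}"


section \<open>Varieties\<close>

datatype lterm =
    Var nat
  | One
  | Inv lterm
  | Mult lterm lterm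
  | Join lterm lterm
  | Meet lterm lterm

primrec lterm_eval :: "('a, 'b) pogroup_scheme \<Rightarrow> (nat \<Rightarrow> 'a) \<Rightarrow> lterm \<Rightarrow> 'a"
  where
    "lterm_eval L v (Var n) = v n"
  | "lterm_eval L v One = \<one>\<^bsub>L\<^esub>"
  | "lterm_eval L v (Inv s) = inv\<^bsub>L\<^esub> (lterm_eval L v s)"
  | "lterm_eval L v (Mult s t) = lterm_eval L v s \<otimes>\<^bsub>L\<^esub> lterm_eval L v t"
  | "lterm_eval L v (Join s t) = gjoin L (lterm_eval L v s) (lterm_eval L v t)"
  | "lterm_eval L v (Meet s t) = gmeet L (lterm_eval L v s) (lterm_eval L v t)"

definition satisfies :: "('a, 'b) pogroup_scheme \<Rightarrow> lterm \<times> lterm \<Rightarrow> bool"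
  where "satisfies L = (\<lambda>(s, t).
    \<forall>v. range v \<subseteq> carrier L \<longrightarrow> lterm_eval L v s = lterm_eval L v t)"

text \<open>A class of structures in HOL lives over one type of elements. As the equations do not
  depend on that type, quantifying over the varieties over a given type is the same as
  quantifying over the sets of equations, hence over all varieties.\<close>

definition l_group_variety :: "'a pogroup set \<Rightarrow> bool"
  where "l_group_variety V \<longleftrightarrow> (\<exists>E. V = {L. l_group L \<and> (\<forall>e\<in>E. satisfies L e)})"


section \<open>Right pre-orders and pre-cones\<close>

definition right_preorder :: "('a, 'b) pogroup_scheme \<Rightarrow> 'a rel \<Rightarrow> bool"
  where "right_preorder G r \<longleftrightarrow>
    preorder_on (carrier G) r \<and> total_on (carrier G) r \<and> r \<noteq> carrier G \<times> carrier G \<and>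
    (\<forall>a\<in>carrier G. \<forall>b\<in>carrier G. a \<preceq>\<^bsub>G\<^esub> b \<longrightarrow> (a, b) \<in> r) \<and>
    (\<forall>a b. \<forall>t\<in>carrier G. (a, b) \<in> r \<longrightarrow> (a \<otimes>\<^bsub>G\<^esub> t, b \<otimes>\<^bsub>G\<^esub> t) \<in> r)"

definition precone_of :: "('a, 'b) pogroup_scheme \<Rightarrow> 'a rel \<Rightarrow> 'a set"
  where "precone_of G r = {a \<in> carrier G. (\<one>\<^bsub>G\<^esub>, a) \<in> r}"

definition precone :: "('a, 'b) pogroup_scheme \<Rightarrow> 'a set \<Rightarrow> bool"
  where "precone G C \<longleftrightarrow> (\<exists>r. right_preorder G r \<and> C = precone_of G r)"

definition precone_rel :: "('a, 'b) pogroup_scheme \<Rightarrow> 'a set \<Rightarrow> 'a rel"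
  where "precone_rel G C =
    {(a, b). a \<in> carrier G \<and> b \<in> carrier G \<and> b \<otimes>\<^bsub>G\<^esub> inv\<^bsub>G\<^esub> a \<in> C}"

lemma (in po_group) precone_rel_precone_of:
  assumes "right_preorder G r"
  shows "precone_rel G (precone_of G r) = r"
proof -
  have r: "r \<subseteq> carrier G \<times> carrier G"
    and tr: "\<And>a b t. t \<in> carrier G \<Longrightarrow> (a, b) \<in> r \<Longrightarrow> (a \<otimes> t, b \<otimes> t) \<in> r"
    using assms unfolding right_preorder_def preorder_on_def by auto
  have "(\<one>, b \<otimes> inv a) \<in> r \<longleftrightarrow> (a, b) \<in> r" if "a \<in> carrier G" "b \<in> carrier G" for a b
  proof
    assume "(\<one>, b \<otimes> inv a) \<in> r"
    from tr[OF that(1) this] show "(a, b) \<in> r"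
      using that by (simp add: m_assoc)
  next
    assume "(a, b) \<in> r"
    from tr[OF inv_closed[OF that(1)] this] show "(\<one>, b \<otimes> inv a) \<in> r"
      using that by simp
  qed
  then show ?thesis
    using r unfolding precone_rel_def precone_of_def by auto
qed

lemma (in po_group) precone_iff:
  "precone G C \<longleftrightarrow>
    submonoid C G \<and> C \<noteq> carrier G \<and> carrier G = C \<union> m_inv G ` C \<and>
    {a \<in> carrier G. \<one> \<preceq> a} \<subseteq> C"
  (is "_ \<longleftrightarrow> ?R")
proof
  assume "precone G C"
  then obtain r where r: "right_preorder G r" and C: "C = precone_of G r"
    unfolding precone_def by blast
  note rel = precone_rel_precone_of[OF r, folded C]
  have sub: "C \<subseteq> carrier G"
    using C unfolding precone_of_def by blast
  have refl: "(a, a) \<in> r" if "a \<in> carrier G" for a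
    using r that unfolding right_preorder_def preorder_on_def refl_on_def by blast
  have trans: "(a, c) \<in> r" if "(a, b) \<in> r" "(b, c) \<in> r" for a b c
    using r that unfolding right_preorder_def preorder_on_def trans_def by blast
  have tot: "(a, b) \<in> r \<or> (b, a) \<in> r" if "a \<in> carrier G" "b \<in> carrier G" for a b
    using r refl that unfolding right_preorder_def total_on_def by metis
  have ne: "r \<noteq> carrier G \<times> carrier G"
    using r unfolding right_preorder_def by simp
  have ext: "(a, b) \<in> r" if "a \<in> carrier G" "b \<in> carrier G" "a \<preceq> b" for a b
    using r that unfolding right_preorder_def by blast
  have tr: "(a \<otimes> t, b \<otimes> t) \<in> r" if "t \<in> carrier G" "(a, b) \<in> r" for a b t
    using r that unfolding right_preorder_def by blast
  have memC: "a \<in> C \<longleftrightarrow> a \<in> carrier G \<and> (\<one>, a) \<in> r" for a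
    unfolding C precone_of_def by simp
  have "submonoid C G"
  proof
    fix x y assume xy: "x \<in> C" "y \<in> C"
    then have "(\<one> \<otimes> y, x \<otimes> y) \<in> r" by (intro tr) (auto simp: memC)
    with xy show "x \<otimes> y \<in> C" by (auto simp: memC intro: trans)
  qed (auto simp: memC refl)
  moreover have "C \<noteq> carrier G"
  proof
    assume "C = carrier G"
    then have "precone_rel G C = carrier G \<times> carrier G" unfolding precone_rel_def by auto
    with rel ne show False by simp
  qed
  moreover have "carrier G = C \<union> m_inv G ` C"
  proof -
    have "a \<in> C \<or> inv a \<in> C" if a: "a \<in> carrier G" for a
      using tot[OF one_closed a] tr[of "inv a" a \<one>] a by (auto simp: memC)
    then have "a \<in> C \<union> m_inv G ` C" if "a \<in> carrier G" for a
      using that by (metis UnCI image_eqI inv_inv)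
    then show ?thesis using sub by auto
  qed
  moreover have "{a \<in> carrier G. \<one> \<preceq> a} \<subseteq> C"
    using ext by (auto simp: memC)
  ultimately show ?R by blast
next
  assume R: ?R
  then interpret C: submonoid C G by blast
  have C_or: "a \<in> C \<or> inv a \<in> C" if a: "a \<in> carrier G" for a
  proof -
    have "a \<in> C \<union> m_inv G ` C" using R a by blast
    then show ?thesis by auto
  qed
  have C_pos: "a \<in> C" if "a \<in> carrier G" "\<one> \<preceq> a" for a
    using R that by blast
  have "right_preorder G (precone_rel G C)"
    unfolding right_preorder_def preorder_on_def
  proof (intro conjI ballI allI impI)
    show "precone_rel G C \<subseteq> carrier G \<times> carrier G" unfolding precone_rel_def by auto
    show "refl_on (carrier G) (precone_rel G C)" unfolding precone_rel_def refl_on_def by simp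
    show "trans (precone_rel G C)"
    proof (rule transI)
      fix a b c assume "(a, b) \<in> precone_rel G C" "(b, c) \<in> precone_rel G C"
      then have *: "a \<in> carrier G" "b \<in> carrier G" "c \<in> carrier G"
        "b \<otimes> inv a \<in> C" "c \<otimes> inv b \<in> C" unfolding precone_rel_def by auto
      have "(c \<otimes> inv b) \<otimes> (b \<otimes> inv a) = c \<otimes> inv a"
        using * by (simp add: m_assoc[symmetric]) (simp add: m_assoc)
      then show "(a, c) \<in> precone_rel G C"
        using * C.m_closed[of "c \<otimes> inv b" "b \<otimes> inv a"] unfolding precone_rel_def by simp
    qed
    show "total_on (carrier G) (precone_rel G C)"
      unfolding total_on_def
    proof (intro ballI impI)
      fix a b assume "a \<in> carrier G" "b \<in> carrier G"
      then show "(a, b) \<in> precone_rel G C \<or> (b, a) \<in> precone_rel G C"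
        using C_or[of "b \<otimes> inv a"] by (simp add: precone_rel_def inv_mult_group)
    qed
    show "precone_rel G C \<noteq> carrier G \<times> carrier G"
    proof
      assume "precone_rel G C = carrier G \<times> carrier G"
      then have "(\<one>, a) \<in> precone_rel G C" if "a \<in> carrier G" for a using that by simp
      then have "carrier G \<subseteq> C" unfolding precone_rel_def by auto
      with R C.subset show False by blast
    qed
  next
    fix a b assume *: "a \<in> carrier G" "b \<in> carrier G" "a \<preceq> b"
    have "\<one> \<preceq> b \<otimes> inv a" using translate[of a b \<one> "inv a"] * by simp
    with * C_pos show "(a, b) \<in> precone_rel G C" unfolding precone_rel_def by simp
  next
    fix a b t assume "t \<in> carrier G" "(a, b) \<in> precone_rel G C"
    then have *: "a \<in> carrier G" "b \<in> carrier G" "t \<in> carrier G" "b \<otimes> inv a \<in> C"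
      unfolding precone_rel_def by auto
    have "t \<otimes> (inv t \<otimes> inv a) = inv a"
      using * by (simp add: m_assoc[symmetric])
    then have "(b \<otimes> t) \<otimes> inv (a \<otimes> t) = b \<otimes> inv a"
      using * by (simp add: inv_mult_group m_assoc)
    with * show "(a \<otimes> t, b \<otimes> t) \<in> precone_rel G C" unfolding precone_rel_def by simp
  qed
  moreover have "C = precone_of G (precone_rel G C)"
    using C.subset unfolding precone_of_def precone_rel_def by auto
  ultimately show "precone G C" unfolding precone_def by blast
qed


section \<open>The \<open>\<ell>\<close>-group of a pre-cone\<close>

definition precone_equiv :: "('a, 'b) pogroup_scheme \<Rightarrow> 'a set \<Rightarrow> 'a rel"
  where "precone_equiv G C = {(a, b). (a, b) \<in> precone_rel G C \<and> (b, a) \<in> precone_rel G C}"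

definition precone_chain :: "('a, 'b) pogroup_scheme \<Rightarrow> 'a set \<Rightarrow> 'a set gorder"
  where "precone_chain G C =
    \<lparr>carrier = carrier G // precone_equiv G C,
     eq = (=),
     le = (\<lambda>X Y. \<exists>a\<in>X. \<exists>b\<in>Y. (a, b) \<in> precone_rel G C)\<rparr>"

text \<open>The product of \<open>f\<close> and \<open>g\<close> is \<open>g\<close> after \<open>f\<close>, opposite to \<^const>\<open>BijGroup\<close>. As there,
  functions are \<^const>\<open>undefined\<close> outside the chain. The lattice operations are those of the
  pointwise order.\<close>

definition order_aut_group :: "('x, 'y) gorder_scheme \<Rightarrow> ('x \<Rightarrow> 'x) pogroup"
  where "order_aut_group W =
    \<lparr>carrier = {f \<in> Bij (carrier W).
       \<forall>x\<in>carrier W. \<forall>y\<in>carrier W. x \<sqsubseteq>\<^bsub>W\<^esub> y \<longrightarrow> f x \<sqsubseteq>\<^bsub>W\<^esub> f y},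
     mult = (\<lambda>f g. compose (carrier W) g f),
     one = (\<lambda>x\<in>carrier W. x),
     leq = (\<lambda>f g. \<forall>x\<in>carrier W. f x \<sqsubseteq>\<^bsub>W\<^esub> g x)\<rparr>"

definition right_translation :: "('a, 'b) pogroup_scheme \<Rightarrow> 'a set \<Rightarrow> 'a \<Rightarrow> 'a set \<Rightarrow> 'a set"
  where "right_translation G C a =
    (\<lambda>X\<in>carrier (precone_chain G C). \<Union>b\<in>X. precone_equiv G C `` {b \<otimes>\<^bsub>G\<^esub> a})"

definition precone_l_group :: "('a, 'b) pogroup_scheme \<Rightarrow> 'a set \<Rightarrow> ('a set \<Rightarrow> 'a set) pogroup"
  where "precone_l_group G C = (order_aut_group (precone_chain G C))
    \<lparr>carrier := l_generate (order_aut_group (precone_chain G C))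
                  (right_translation G C ` carrier G)\<rparr>"


section \<open>The space of right pre-orders\<close>

definition precones :: "('a set \<Rightarrow> 'a set) pogroup set \<Rightarrow> ('a, 'b) pogroup_scheme \<Rightarrow> 'a set set"
  where "precones V G = {C. precone G C \<and> precone_l_group G C \<in> V}"

definition precone_basic ::
    "('a set \<Rightarrow> 'a set) pogroup set \<Rightarrow> ('a, 'b) pogroup_scheme \<Rightarrow> 'a \<Rightarrow> 'a set set"
  where "precone_basic V G a = {C \<in> precones V G. a \<in> C \<and> inv\<^bsub>G\<^esub> a \<notin> C}"

definition precone_space ::
    "('a set \<Rightarrow> 'a set) pogroup set \<Rightarrow> ('a, 'b) pogroup_scheme \<Rightarrow> 'a set topology"
  where "precone_space V G =
    topology_generated_by (insert (precones V G) (precone_basic V G ` carrier G))"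

lemma topspace_precone_space [simp]: "topspace (precone_space V G) = precones V G"
  unfolding precone_space_def precone_basic_def by auto


section \<open>Generalised spectral spaces\<close>

definition irreducible_closedin :: "'a topology \<Rightarrow> 'a set \<Rightarrow> bool"
  where "irreducible_closedin X S \<longleftrightarrow> closedin X S \<and> S \<noteq> {} \<and>
    \<not> (\<exists>A B. closedin X A \<and> closedin X B \<and> A \<subset> S \<and> B \<subset> S \<and> S = A \<union> B)"

definition sober_space :: "'a topology \<Rightarrow> bool"
  where "sober_space X \<longleftrightarrow>
    (\<forall>S. irreducible_closedin X S \<longrightarrow> (\<exists>!x. x \<in> topspace X \<and> S = X closure_of {x}))"

definition compact_openin :: "'a topology \<Rightarrow> 'a set \<Rightarrow> bool"
  where "compact_openin X U \<longleftrightarrow> compactin X U \<and> openin X U"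

definition generalised_spectral_space :: "'a topology \<Rightarrow> bool"
  where "generalised_spectral_space X \<longleftrightarrow>
    sober_space X \<and>
    openin X = arbitrary union_of compact_openin X \<and>
    (\<forall>U V. compact_openin X U \<and> compact_openin X V \<longrightarrow> compact_openin X (U \<inter> V))"

definition specialises :: "'a topology \<Rightarrow> 'a \<Rightarrow> 'a \<Rightarrow> bool"
  where "specialises X x y \<longleftrightarrow> x \<in> topspace X \<and> y \<in> X closure_of {x}"

text \<open>Complete normality in the sense of spectral spaces, unrelated to the \<open>T\<^sub>5\<close> axiom
  for Hausdorff spaces.\<close>

definition completely_normal_generalised_spectral_space :: "'a topology \<Rightarrow> bool"
  where "completely_normal_generalised_spectral_space X \<longleftrightarrow>
    generalised_spectral_space X \<and>
    (\<forall>x y z. z \<in> topspace X \<and> x \<in> X closure_of {z} \<and> y \<in> X closure_of {z} \<longrightarrow>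
       x \<in> X closure_of {y} \<or> y \<in> X closure_of {x})"

end

(* The pre-cones lie in the Cantor cube of all subsets of G. The crucial point is that
   H_C in V is a closed condition there. Consider sections: families assigning to each pre-cone C
   an element of H_C, such that the image of each class [b] is represented, near C, by one and
   the same element of G. They are closed under the l-group operations and contain the right
   translations, so each element of H_C is the value at C of a section. Thus an equation failing
   in H_C at some [b] also fails in H_D for all D close to C.

   Since a pre-cone contains a or the inverse of a, the basic open set P(a) consists of the C that
   avoid the inverse of a, so the sets of pre-cones avoiding a nonempty finite set form a base.
   Closedness makes them compact, since avoiding an element prevents limits from degenerating to
   all of G, and makes the intersection of the members of an irreducible closed set its generic
   point. Finally, two pre-cones above a common pre-cone are comparable. *)

theory Submission
  imports Defs "HOL-Analysis.Function_Topology"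
begin

section \<open>Order automorphisms of a chain\<close>

text \<open>Comparing the two values, instead of taking an abstract join, makes each value literally
  \<open>f x\<close> or \<open>g x\<close>. The function is restricted to the chain because
  automorphisms are extensional functions.\<close>

definition aut_max :: "('x, 'y) gorder_scheme \<Rightarrow> ('x \<Rightarrow> 'x) \<Rightarrow> ('x \<Rightarrow> 'x) \<Rightarrow> 'x \<Rightarrow> 'x"
  where "aut_max W f g = (\<lambda>x\<in>carrier W. if f x \<sqsubseteq>\<^bsub>W\<^esub> g x then g x else f x)"

text \<open>The test is oriented so that this is literally \<open>aut_max\<close> over the reversed
  chain.\<close>

definition aut_min :: "('x, 'y) gorder_scheme \<Rightarrow> ('x \<Rightarrow> 'x) \<Rightarrow> ('x \<Rightarrow> 'x) \<Rightarrow> 'x \<Rightarrow> 'x"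
  where "aut_min W f g = (\<lambda>x\<in>carrier W. if g x \<sqsubseteq>\<^bsub>W\<^esub> f x then g x else f x)"

lemma aut_max_dual: "aut_max (inv_gorder W) f g = aut_min W f g"
  by (simp add: aut_max_def aut_min_def)

lemma order_aut_group_simps [simp]:
  "f \<otimes>\<^bsub>order_aut_group W\<^esub> g = compose (carrier W) g f"
  "\<one>\<^bsub>order_aut_group W\<^esub> = (\<lambda>x\<in>carrier W. x)"
  "leq (order_aut_group W) f g \<longleftrightarrow> (\<forall>x\<in>carrier W. f x \<sqsubseteq>\<^bsub>W\<^esub> g x)"
  by (simp_all add: order_aut_group_def)

lemma order_reduct_simps [simp]:
  "carrier (order_reduct G) = carrier G"
  "le (order_reduct G) = leq G"
  "eq (order_reduct G) = (=)"
  by (simp_all add: order_reduct_def)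

lemma partial_order_order_reduct_iff:
  "partial_order (order_reduct G) \<longleftrightarrow>
    (\<forall>x\<in>carrier G. leq G x x) \<and>
    (\<forall>x\<in>carrier G. \<forall>y\<in>carrier G. leq G x y \<longrightarrow> leq G y x \<longrightarrow> x = y) \<and>
    (\<forall>x\<in>carrier G. \<forall>y\<in>carrier G. \<forall>z\<in>carrier G. leq G x y \<longrightarrow> leq G y z \<longrightarrow> leq G x z)"
  (is "_ \<longleftrightarrow> ?R")
proof
  assume "partial_order (order_reduct G)"
  then interpret partial_order "order_reduct G" .
  show ?R
  proof (intro conjI ballI impI)
    fix x y z assume xyz: "x \<in> carrier G" "y \<in> carrier G" "z \<in> carrier G"
    from xyz show "leq G x x" using le_refl[of x] by simp
    show "x = y" if "leq G x y" "leq G y x" using that xyz le_antisym[of x y] by simp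
    show "leq G x z" if "leq G x y" "leq G y z" using that xyz le_trans[of x y z] by simp
  qed
next
  assume ?R
  then show "partial_order (order_reduct G)"
    by unfold_locales (unfold order_reduct_simps; blast)+
qed

lemma total_order_inv_gorder:
  assumes "total_order W"
  shows "total_order (inv_gorder W)"
proof -
  interpret total_order W by fact
  interpret dual: partial_order "inv_gorder W" by (rule dual_order)
  show ?thesis
    by unfold_locales (use total in auto)
qed

section \<open>Automorphisms of a chain and their pointwise maxima\<close>

context total_order
begin

text \<open>Injectivity comes for free: equal images are comparable both ways, so reflection of the
  order and antisymmetry identify the arguments.\<close>

lemma order_autI:
  assumes "f \<in> extensional (carrier L)" "f ` carrier L = carrier L"
    and "\<And>x y. x \<in> carrier L \<Longrightarrow> y \<in> carrier L \<Longrightarrow> f x \<sqsubseteq> f y \<longleftrightarrow> x \<sqsubseteq> y"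
  shows "f \<in> carrier (order_aut_group L)"
proof -
  have "inj_on f (carrier L)"
  proof (rule inj_onI)
    fix x y assume "x \<in> carrier L" "y \<in> carrier L" "f x = f y"
    then have "x \<sqsubseteq> y" "y \<sqsubseteq> x" using assms(2,3) by (metis imageI le_refl)+
    then show "x = y" using \<open>x \<in> carrier L\<close> \<open>y \<in> carrier L\<close> by (rule le_antisym)
  qed
  then show ?thesis
    using assms unfolding order_aut_group_def Bij_def bij_betw_def by simp
qed

text \<open>The carrier only asks for preservation of the order. Reflection uses totality: if
  \<open>x \<sqsubseteq> y\<close> fails, then \<open>f y \<sqsubseteq> f x\<close>, and together
  with \<open>f x \<sqsubseteq> f y\<close> this contradicts injectivity.\<close>

lemma order_autD:
  assumes f: "f \<in> carrier (order_aut_group L)"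
  shows "f \<in> extensional (carrier L)" "f ` carrier L = carrier L"
    and "x \<in> carrier L \<Longrightarrow> f x \<in> carrier L"
    and "x \<in> carrier L \<Longrightarrow> y \<in> carrier L \<Longrightarrow> f x \<sqsubseteq> f y \<longleftrightarrow> x \<sqsubseteq> y"
    and "x \<in> carrier L \<Longrightarrow> y \<in> carrier L \<Longrightarrow> f x = f y \<longleftrightarrow> x = y"
proof -
  have bij: "bij_betw f (carrier L) (carrier L)" and ext: "f \<in> extensional (carrier L)"
    and mono: "\<And>x y. x \<in> carrier L \<Longrightarrow> y \<in> carrier L \<Longrightarrow> x \<sqsubseteq> y \<Longrightarrow> f x \<sqsubseteq> f y"
    using f unfolding order_aut_group_def Bij_def by auto
  have closed: "f x \<in> carrier L" if "x \<in> carrier L" for x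
    using bij that by (rule bij_betw_apply)
  have inj: "f x = f y \<longleftrightarrow> x = y" if "x \<in> carrier L" "y \<in> carrier L" for x y
    using bij that by (auto simp: bij_betw_def inj_on_def)
  show "f \<in> extensional (carrier L)" by fact
  show "f ` carrier L = carrier L" using bij by (simp add: bij_betw_def)
  show "x \<in> carrier L \<Longrightarrow> f x \<in> carrier L" by (rule closed)
  show "x \<in> carrier L \<Longrightarrow> y \<in> carrier L \<Longrightarrow> f x = f y \<longleftrightarrow> x = y" by (rule inj)
  assume xy: "x \<in> carrier L" "y \<in> carrier L"
  show "f x \<sqsubseteq> f y \<longleftrightarrow> x \<sqsubseteq> y"
  proof
    assume *: "f x \<sqsubseteq> f y"
    show "x \<sqsubseteq> y"
    proof (rule ccontr)
      assume "\<not> x \<sqsubseteq> y"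
      with xy total have "y \<sqsubseteq> x" by blast
      with * mono xy closed have "f x = f y" by (meson le_antisym)
      with \<open>\<not> x \<sqsubseteq> y\<close> inj xy show False by auto
    qed
  qed (use mono xy in blast)
qed

lemma order_aut_eqI:
  assumes "f \<in> carrier (order_aut_group L)" "g \<in> carrier (order_aut_group L)"
    and "\<And>x. x \<in> carrier L \<Longrightarrow> f x = g x"
  shows "f = g"
  using extensionalityI[OF order_autD(1)[OF assms(1)] order_autD(1)[OF assms(2)] assms(3)] .

lemma order_aut_inverse:
  assumes f: "f \<in> carrier (order_aut_group L)"
  shows "restrict (inv_into (carrier L) f) (carrier L) \<in> carrier (order_aut_group L)"
    and "compose (carrier L) (restrict (inv_into (carrier L) f) (carrier L)) f = (\<lambda>x\<in>carrier L. x)"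
proof -
  have B: "f \<in> Bij (carrier L)" using f by (simp add: order_aut_group_def)
  from Bij_compose_restrict_eq[OF B]
  show "compose (carrier L) (restrict (inv_into (carrier L) f) (carrier L)) f = (\<lambda>x\<in>carrier L. x)" .
  have "inv_into (carrier L) f x \<sqsubseteq> inv_into (carrier L) f y \<longleftrightarrow> x \<sqsubseteq> y"
    if "x \<in> carrier L" "y \<in> carrier L" for x y
    using order_autD(4)[OF f Bij_inv_into_mem[OF B that(1)] Bij_inv_into_mem[OF B that(2)]] that
    by (simp add: order_autD(2)[OF f] f_inv_into_f)
  moreover have "restrict (inv_into (carrier L) f) (carrier L) ` carrier L = carrier L"
    using restrict_inv_into_Bij[OF B] by (simp add: Bij_def bij_betw_def)
  ultimately show "restrict (inv_into (carrier L) f) (carrier L) \<in> carrier (order_aut_group L)"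
    by (intro order_autI) auto
qed

lemma group_order_aut_group: "group (order_aut_group L)"
proof (rule groupI)
  fix f g assume "f \<in> carrier (order_aut_group L)" "g \<in> carrier (order_aut_group L)"
  note f = order_autD[OF this(1)] and g = order_autD[OF this(2)]
  have "compose (carrier L) g f ` carrier L = g ` f ` carrier L"
    by (auto simp: compose_def)
  then show "f \<otimes>\<^bsub>order_aut_group L\<^esub> g \<in> carrier (order_aut_group L)"
    using f g by (intro order_autI) (auto simp: compose_def)
next
  show "\<one>\<^bsub>order_aut_group L\<^esub> \<in> carrier (order_aut_group L)"
    by (intro order_autI) auto
next
  fix f g h assume "f \<in> carrier (order_aut_group L)" "g \<in> carrier (order_aut_group L)"
    "h \<in> carrier (order_aut_group L)"
  note f = order_autD[OF this(1)] and g = order_autD[OF this(2)]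
  show "f \<otimes>\<^bsub>order_aut_group L\<^esub> g \<otimes>\<^bsub>order_aut_group L\<^esub> h =
      f \<otimes>\<^bsub>order_aut_group L\<^esub> (g \<otimes>\<^bsub>order_aut_group L\<^esub> h)"
    using f(3) by (auto simp: compose_def fun_eq_iff)
next
  fix f assume f: "f \<in> carrier (order_aut_group L)"
  show "\<one>\<^bsub>order_aut_group L\<^esub> \<otimes>\<^bsub>order_aut_group L\<^esub> f = f"
    using order_autD(1)[OF f] by (auto simp: compose_def fun_eq_iff extensional_def)
  show "\<exists>g\<in>carrier (order_aut_group L). g \<otimes>\<^bsub>order_aut_group L\<^esub> f = \<one>\<^bsub>order_aut_group L\<^esub>"
  proof
    let ?g = "restrict (inv_into (carrier L) f) (carrier L)"
    show "?g \<in> carrier (order_aut_group L)" by (rule order_aut_inverse[OF f])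
    show "?g \<otimes>\<^bsub>order_aut_group L\<^esub> f = \<one>\<^bsub>order_aut_group L\<^esub>"
      using order_autD(2)[OF f] by (auto simp: compose_def fun_eq_iff f_inv_into_f)
  qed
qed

lemma aut_max_closed:
  assumes "f \<in> carrier (order_aut_group L)" "g \<in> carrier (order_aut_group L)"
  shows "aut_max L f g \<in> carrier (order_aut_group L)"
proof (rule order_autI)
  note f = order_autD[OF assms(1)] and g = order_autD[OF assms(2)]
  let ?m = "aut_max L f g"
  \<comment> \<open>These facts characterise the maximum: it bounds both values and is one of them.
    Hence it lies below a point iff both values do, and a bound by it is a bound by
    \<open>f y\<close> or by \<open>g y\<close>.\<close>
  have m: "?m x \<in> {f x, g x}" "f x \<sqsubseteq> ?m x" "g x \<sqsubseteq> ?m x" "?m x \<in> carrier L" if "x \<in> carrier L" for x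
    using that f(3)[OF that] g(3)[OF that] total[of "f x" "g x"] by (auto simp: aut_max_def)
  show "?m \<in> extensional (carrier L)" by (simp add: aut_max_def)
  show "?m x \<sqsubseteq> ?m y \<longleftrightarrow> x \<sqsubseteq> y" if x: "x \<in> carrier L" and y: "y \<in> carrier L" for x y
  proof
    assume "x \<sqsubseteq> y"
    then have "f x \<sqsubseteq> f y" "g x \<sqsubseteq> g y" using x y f(4) g(4) by auto
    then have "f x \<sqsubseteq> ?m y" "g x \<sqsubseteq> ?m y"
      using le_trans[OF _ m(2)[OF y]] le_trans[OF _ m(3)[OF y]] x y f(3) g(3) m(4) by auto
    then show "?m x \<sqsubseteq> ?m y" using m(1)[OF x] by auto
  next
    assume "?m x \<sqsubseteq> ?m y"
    then have "f x \<sqsubseteq> ?m y" "g x \<sqsubseteq> ?m y"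
      using le_trans[OF m(2)[OF x]] le_trans[OF m(3)[OF x]] x y f(3) g(3) m(4) by auto
    then show "x \<sqsubseteq> y" using m(1)[OF y] f(4)[OF x y] g(4)[OF x y] by auto
  qed
  show "aut_max L f g ` carrier L = carrier L"
  proof
    show "aut_max L f g ` carrier L \<subseteq> carrier L"
      using f(3) g(3) by (auto simp: aut_max_def)
    show "carrier L \<subseteq> aut_max L f g ` carrier L"
    proof
      fix y assume y: "y \<in> carrier L"
      \<comment> \<open>The smaller of the two preimages works: there one function takes the value
        \<open>y\<close>, and the other a value below \<open>y\<close> by monotonicity.\<close>
      obtain u v where u: "u \<in> carrier L" "f u = y" and v: "v \<in> carrier L" "g v = y"
        using y f(2) g(2) by (metis imageE)
      consider "u \<sqsubseteq> v" | "v \<sqsubseteq> u" using total u v by blast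
      then show "y \<in> aut_max L f g ` carrier L"
      proof cases
        case 1
        then have "g u \<sqsubseteq> y" using g(4) u v by metis
        then have "aut_max L f g u = y"
          using u y g(3) by (simp add: aut_max_def le_antisym)
        then show ?thesis using u by blast
      next
        case 2
        then have "f v \<sqsubseteq> y" using f(4) u v by metis
        then have "aut_max L f g v = y"
          using v by (simp add: aut_max_def)
        then show ?thesis using v by blast
      qed
    qed
  qed
qed

lemma partial_order_aut_subset:
  assumes "S \<subseteq> carrier (order_aut_group L)"
  shows "partial_order (order_reduct ((order_aut_group L)\<lparr>carrier := S\<rparr>))"
proof -
  have S: "f x \<in> carrier L" if "f \<in> S" "x \<in> carrier L" for f x
    using assms that order_autD(3) by blast
  show ?thesis
    unfolding partial_order_order_reduct_iff
  proof (intro conjI ballI impI)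
    fix f assume "f \<in> carrier ((order_aut_group L)\<lparr>carrier := S\<rparr>)"
    then show "leq ((order_aut_group L)\<lparr>carrier := S\<rparr>) f f" using S by simp
  next
    fix f g
    assume "f \<in> carrier ((order_aut_group L)\<lparr>carrier := S\<rparr>)"
      "g \<in> carrier ((order_aut_group L)\<lparr>carrier := S\<rparr>)"
      "leq ((order_aut_group L)\<lparr>carrier := S\<rparr>) f g"
      "leq ((order_aut_group L)\<lparr>carrier := S\<rparr>) g f"
    then have "f \<in> S" "g \<in> S" "\<And>x. x \<in> carrier L \<Longrightarrow> f x = g x"
      using S by (simp_all add: le_antisym)
    then show "f = g" using assms by (intro order_aut_eqI) blast+
  next
    fix f g h
    assume "f \<in> carrier ((order_aut_group L)\<lparr>carrier := S\<rparr>)"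
      "g \<in> carrier ((order_aut_group L)\<lparr>carrier := S\<rparr>)"
      "h \<in> carrier ((order_aut_group L)\<lparr>carrier := S\<rparr>)"
      "leq ((order_aut_group L)\<lparr>carrier := S\<rparr>) f g"
      "leq ((order_aut_group L)\<lparr>carrier := S\<rparr>) g h"
    then show "leq ((order_aut_group L)\<lparr>carrier := S\<rparr>) f h"
      using S le_trans[of "f x" "g x" "h x" for x] by simp
  qed
qed

text \<open>The join is formed inside the carrier, so it might change when the carrier shrinks.
  Stating this for every \<open>S\<close> that contains the pointwise maximum covers both the full
  automorphism group and each of its sublattice subgroups.\<close>

lemma aut_join:
  assumes S: "S \<subseteq> carrier (order_aut_group L)" and fg: "f \<in> S" "g \<in> S" "aut_max L f g \<in> S"
  shows "least (order_reduct ((order_aut_group L)\<lparr>carrier := S\<rparr>)) (aut_max L f g)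
      (Upper (order_reduct ((order_aut_group L)\<lparr>carrier := S\<rparr>)) {f, g})"
    and "gjoin ((order_aut_group L)\<lparr>carrier := S\<rparr>) f g = aut_max L f g"
proof -
  let ?R = "order_reduct ((order_aut_group L)\<lparr>carrier := S\<rparr>)"
  interpret R: partial_order ?R by (rule partial_order_aut_subset[OF S])
  have c: "f x \<in> carrier L" "g x \<in> carrier L" if "x \<in> carrier L" for x
    using order_autD(3) S fg(1,2) that by blast+
  have t: "g x \<sqsubseteq> f x" if "\<not> f x \<sqsubseteq> g x" "x \<in> carrier L" for x
    using total[OF c(1,2)] that by blast
  show l: "least ?R (aut_max L f g) (Upper ?R {f, g})"
  proof (rule least_UpperI)
    fix h assume "h \<in> {f, g}"
    then show "h \<sqsubseteq>\<^bsub>?R\<^esub> aut_max L f g"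
      using c t by (auto simp: aut_max_def)
  next
    fix h assume "h \<in> Upper ?R {f, g}"
    then show "aut_max L f g \<sqsubseteq>\<^bsub>?R\<^esub> h"
      using fg by (auto simp: aut_max_def Upper_def)
  qed (use fg in auto)
  \<comment> \<open>The library chooses the supremum by \<open>SOME\<close>; it is identified
    through uniqueness of least elements.\<close>
  then have "least ?R (SOME u. least ?R u (Upper ?R {f, g})) (Upper ?R {f, g})"
    by (rule someI[where P = "\<lambda>u. least ?R u (Upper ?R {f, g})"])
  then show "gjoin ((order_aut_group L)\<lparr>carrier := S\<rparr>) f g = aut_max L f g"
    unfolding join_def sup_def using l by (rule R.least_unique)
qed

end

text \<open>Reversing the chain keeps the automorphisms and reverses their pointwise order. Thus
  everything about minima and meets follows from maxima and joins over the reversed chain.\<close>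

lemma order_aut_group_dual:
  "carrier (order_aut_group (inv_gorder W)) = carrier (order_aut_group W)"
  "order_reduct ((order_aut_group (inv_gorder W))\<lparr>carrier := S\<rparr>) =
    inv_gorder (order_reduct ((order_aut_group W)\<lparr>carrier := S\<rparr>))"
  by (auto simp: order_aut_group_def order_reduct_def)

section \<open>Meets by duality, and sublattice subgroups\<close>

context total_order
begin

lemma aut_min_closed:
  assumes "f \<in> carrier (order_aut_group L)" "g \<in> carrier (order_aut_group L)"
  shows "aut_min L f g \<in> carrier (order_aut_group L)"
  using total_order.aut_max_closed[OF total_order_inv_gorder[OF total_order_axioms]] assms
  unfolding order_aut_group_dual aut_max_dual by blast

lemma aut_meet:
  assumes S: "S \<subseteq> carrier (order_aut_group L)" and fg: "f \<in> S" "g \<in> S" "aut_min L f g \<in> S"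
  shows "greatest (order_reduct ((order_aut_group L)\<lparr>carrier := S\<rparr>)) (aut_min L f g)
      (Lower (order_reduct ((order_aut_group L)\<lparr>carrier := S\<rparr>)) {f, g})"
    and "gmeet ((order_aut_group L)\<lparr>carrier := S\<rparr>) f g = aut_min L f g"
  using total_order.aut_join[OF total_order_inv_gorder[OF total_order_axioms], of S f g] assms
  unfolding order_aut_group_dual aut_max_dual join_dual least_dual Upper_dual by blast+

lemma aut_join_full:
  assumes "f \<in> carrier (order_aut_group L)" "g \<in> carrier (order_aut_group L)"
  shows "gjoin (order_aut_group L) f g = aut_max L f g"
  using aut_join(2)[OF order_refl assms aut_max_closed[OF assms]] by simp

lemma aut_meet_full:
  assumes "f \<in> carrier (order_aut_group L)" "g \<in> carrier (order_aut_group L)"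
  shows "gmeet (order_aut_group L) f g = aut_min L f g"
  using aut_meet(2)[OF order_refl assms aut_min_closed[OF assms]] by simp

lemma l_subgroup_order_aut_group_iff:
  "l_subgroup S (order_aut_group L) \<longleftrightarrow> subgroup S (order_aut_group L) \<and>
    (\<forall>f\<in>S. \<forall>g\<in>S. aut_max L f g \<in> S \<and> aut_min L f g \<in> S)"
proof (cases "subgroup S (order_aut_group L)")
  case True
  then have "S \<subseteq> carrier (order_aut_group L)" by (rule subgroup.subset)
  then have "gjoin (order_aut_group L) f g = aut_max L f g"
    "gmeet (order_aut_group L) f g = aut_min L f g" if "f \<in> S" "g \<in> S" for f g
    using that by (simp_all add: aut_join_full aut_meet_full subset_iff)
  then show ?thesis by (simp add: l_subgroup_def)
qed (simp add: l_subgroup_def)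

lemma l_group_l_subgroup:
  assumes "l_subgroup S (order_aut_group L)"
  shows "l_group ((order_aut_group L)\<lparr>carrier := S\<rparr>)"
proof -
  have sub: "subgroup S (order_aut_group L)"
    and ml: "\<And>f g. f \<in> S \<Longrightarrow> g \<in> S \<Longrightarrow> aut_max L f g \<in> S"
      "\<And>f g. f \<in> S \<Longrightarrow> g \<in> S \<Longrightarrow> aut_min L f g \<in> S"
    using assms l_subgroup_order_aut_group_iff by auto
  have S: "S \<subseteq> carrier (order_aut_group L)" using sub by (rule subgroup.subset)
  interpret H: group "(order_aut_group L)\<lparr>carrier := S\<rparr>"
    using sub group_order_aut_group by (rule subgroup.subgroup_is_group)
  interpret R: partial_order "order_reduct ((order_aut_group L)\<lparr>carrier := S\<rparr>)"
    by (rule partial_order_aut_subset[OF S])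
  show ?thesis
  proof unfold_locales
    fix a b s t
    assume *: "a \<in> carrier ((order_aut_group L)\<lparr>carrier := S\<rparr>)"
      "b \<in> carrier ((order_aut_group L)\<lparr>carrier := S\<rparr>)"
      "s \<in> carrier ((order_aut_group L)\<lparr>carrier := S\<rparr>)"
      "t \<in> carrier ((order_aut_group L)\<lparr>carrier := S\<rparr>)"
      "leq ((order_aut_group L)\<lparr>carrier := S\<rparr>) a b"
    then have "a \<in> carrier (order_aut_group L)" "b \<in> carrier (order_aut_group L)"
      "s \<in> carrier (order_aut_group L)" "t \<in> carrier (order_aut_group L)" using S by auto
    \<comment> \<open>With the reversed composition the product of \<open>s\<close>,
      \<open>a\<close>, \<open>t\<close> sends \<open>x\<close> to \<open>t (a (s x))\<close>: the
      inequality is applied at the point \<open>s x\<close>, and then \<open>t\<close> preserves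
      it.\<close>
    note this[THEN order_autD(3)] order_autD(4)[OF this(4)]
    with *(5) show "leq ((order_aut_group L)\<lparr>carrier := S\<rparr>)
        (s \<otimes>\<^bsub>(order_aut_group L)\<lparr>carrier := S\<rparr>\<^esub> a \<otimes>\<^bsub>(order_aut_group L)\<lparr>carrier := S\<rparr>\<^esub> t)
        (s \<otimes>\<^bsub>(order_aut_group L)\<lparr>carrier := S\<rparr>\<^esub> b \<otimes>\<^bsub>(order_aut_group L)\<lparr>carrier := S\<rparr>\<^esub> t)"
      by (simp add: compose_def)
  next
    fix f g
    assume "f \<in> carrier (order_reduct ((order_aut_group L)\<lparr>carrier := S\<rparr>))"
      "g \<in> carrier (order_reduct ((order_aut_group L)\<lparr>carrier := S\<rparr>))"
    then have fg: "f \<in> S" "g \<in> S" by simp_all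
    show "\<exists>s. is_lub (order_reduct ((order_aut_group L)\<lparr>carrier := S\<rparr>)) s {f, g}"
      using aut_join(1)[OF S fg ml(1)[OF fg]] by blast
    show "\<exists>s. is_glb (order_reduct ((order_aut_group L)\<lparr>carrier := S\<rparr>)) s {f, g}"
      using aut_meet(1)[OF S fg ml(2)[OF fg]] by blast
  qed
qed

lemma l_subgroup_carrier: "l_subgroup (carrier (order_aut_group L)) (order_aut_group L)"
  unfolding l_subgroup_order_aut_group_iff
  by (simp add: aut_max_closed aut_min_closed group.subgroup_self[OF group_order_aut_group])

lemma l_subgroup_l_generate:
  assumes "S \<subseteq> carrier (order_aut_group L)"
  shows "l_subgroup (l_generate (order_aut_group L) S) (order_aut_group L)"
  unfolding l_subgroup_order_aut_group_iff
proof (intro conjI ballI)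
  show "subgroup (l_generate (order_aut_group L) S) (order_aut_group L)"
    unfolding l_generate_def
  proof (rule group.subgroups_Inter[OF group_order_aut_group])
    \<comment> \<open>The intersection must not run over an empty family; the full automorphism
      group belongs to it.\<close>
    show "{H. l_subgroup H (order_aut_group L) \<and> S \<subseteq> H} \<noteq> {}"
      using l_subgroup_carrier assms by blast
  qed (simp add: l_subgroup_def)
qed (auto simp: l_generate_def l_subgroup_order_aut_group_iff)

end


section \<open>The chain of a pre-cone\<close>

abbreviation precone_class :: "('a, 'b) pogroup_scheme \<Rightarrow> 'a set \<Rightarrow> 'a \<Rightarrow> 'a set"
  where "precone_class G C a \<equiv> precone_equiv G C `` {a}"

section \<open>Comparison of classes and right translations\<close>

context po_group
begin

lemma precone_subset: "precone G C \<Longrightarrow> C \<subseteq> carrier G"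
  by (auto simp: precone_def precone_of_def)

lemma preconeD:
  assumes "precone G C"
  shows "\<one> \<in> C" "x \<in> C \<Longrightarrow> y \<in> C \<Longrightarrow> x \<otimes> y \<in> C" "C \<noteq> carrier G"
    "x \<in> carrier G \<Longrightarrow> x \<in> C \<or> inv x \<in> C" "x \<in> carrier G \<Longrightarrow> \<one> \<preceq> x \<Longrightarrow> x \<in> C"
proof -
  have sub: "submonoid C G" and ne: "C \<noteq> carrier G" and un: "carrier G = C \<union> m_inv G ` C"
    and pos: "{a \<in> carrier G. \<one> \<preceq> a} \<subseteq> C"
    using assms unfolding precone_iff by blast+
  show "\<one> \<in> C" "x \<in> C \<Longrightarrow> y \<in> C \<Longrightarrow> x \<otimes> y \<in> C"
    using submonoid.one_closed[OF sub] submonoid.m_closed[OF sub] by auto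
  show "C \<noteq> carrier G" by (rule ne)
  show "x \<in> carrier G \<Longrightarrow> \<one> \<preceq> x \<Longrightarrow> x \<in> C" using pos by blast
  assume "x \<in> carrier G"
  then have "x \<in> C \<union> m_inv G ` C" using un by blast
  then show "x \<in> C \<or> inv x \<in> C"
    using submonoid.subset[OF sub] by (auto simp: subset_iff)
qed

lemma precone_rel_iff [simp]:
  "a \<in> carrier G \<Longrightarrow> b \<in> carrier G \<Longrightarrow> (a, b) \<in> precone_rel G C \<longleftrightarrow> b \<otimes> inv a \<in> C"
  by (simp add: precone_rel_def)

lemma right_preorder_precone_rel:
  assumes "precone G C"
  shows "right_preorder G (precone_rel G C)"
  using assms precone_rel_precone_of unfolding precone_def by auto

lemma precone_rel_carrier: "(a, b) \<in> precone_rel G C \<Longrightarrow> a \<in> carrier G \<and> b \<in> carrier G"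
  by (simp add: precone_rel_def)

lemma precone_rel_refl: "precone G C \<Longrightarrow> a \<in> carrier G \<Longrightarrow> (a, a) \<in> precone_rel G C"
  using preconeD(1) by simp

lemma precone_rel_trans:
  "precone G C \<Longrightarrow> (a, b) \<in> precone_rel G C \<Longrightarrow> (b, c) \<in> precone_rel G C \<Longrightarrow>
    (a, c) \<in> precone_rel G C"
  using right_preorder_precone_rel unfolding right_preorder_def preorder_on_def trans_def by blast

lemma precone_rel_total:
  "precone G C \<Longrightarrow> a \<in> carrier G \<Longrightarrow> b \<in> carrier G \<Longrightarrow>
    (a, b) \<in> precone_rel G C \<or> (b, a) \<in> precone_rel G C"
  using preconeD(4)[of C "b \<otimes> inv a"] by (simp add: inv_mult_group)

text \<open>The quotient of \<open>b \<otimes> t\<close> by \<open>a \<otimes> t\<close> is again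
  \<open>b \<otimes> inv a\<close>. Being an equivalence, this shows that right translations both
  preserve and reflect the order.\<close>

lemma precone_rel_mult_right:
  assumes "a \<in> carrier G" "b \<in> carrier G" "t \<in> carrier G"
  shows "(a \<otimes> t, b \<otimes> t) \<in> precone_rel G C \<longleftrightarrow> (a, b) \<in> precone_rel G C"
proof -
  have "t \<otimes> (inv t \<otimes> inv a) = inv a"
    using assms by (simp add: m_assoc[symmetric])
  then have "(b \<otimes> t) \<otimes> inv (a \<otimes> t) = b \<otimes> inv a"
    using assms by (simp add: inv_mult_group m_assoc)
  then show ?thesis using assms by simp
qed

lemma equiv_precone_equiv:
  assumes "precone G C"
  shows "equiv (carrier G) (precone_equiv G C)"
proof (rule equivI)
  show "precone_equiv G C \<subseteq> carrier G \<times> carrier G"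
    unfolding precone_equiv_def using precone_rel_carrier by blast
  show "refl_on (carrier G) (precone_equiv G C)"
    unfolding precone_equiv_def refl_on_def using precone_rel_refl[OF assms] by blast
  show "sym (precone_equiv G C)"
    unfolding precone_equiv_def sym_def by blast
  show "trans (precone_equiv G C)"
    unfolding precone_equiv_def trans_def using precone_rel_trans[OF assms] by blast
qed

lemma precone_class_eq_iff:
  assumes "precone G C" "a \<in> carrier G" "b \<in> carrier G"
  shows "precone_class G C a = precone_class G C b \<longleftrightarrow> b \<otimes> inv a \<in> C \<and> a \<otimes> inv b \<in> C"
  using eq_equiv_class_iff[OF equiv_precone_equiv[OF assms(1)] assms(2,3)] assms
  by (simp add: precone_equiv_def)

lemma carrier_precone_chain: "carrier (precone_chain G C) = precone_class G C ` carrier G"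
  by (auto simp: precone_chain_def quotient_def)

lemma precone_class_in_chain: "a \<in> carrier G \<Longrightarrow> precone_class G C a \<in> carrier (precone_chain G C)"
  by (simp add: carrier_precone_chain)

lemma precone_class_le_iff:
  assumes "precone G C" "a \<in> carrier G" "b \<in> carrier G"
  shows "precone_class G C a \<sqsubseteq>\<^bsub>precone_chain G C\<^esub> precone_class G C b \<longleftrightarrow> b \<otimes> inv a \<in> C"
proof -
  \<comment> \<open>The order of the chain only asks for some related representatives; transitivity
    carries the relation over to the given ones.\<close>
  have "(a, b) \<in> precone_rel G C"
    if "(a, x) \<in> precone_equiv G C" "(b, y) \<in> precone_equiv G C" "(x, y) \<in> precone_rel G C" for x y
    using that precone_rel_trans[OF assms(1)] unfolding precone_equiv_def by blast
  moreover have "(a, a) \<in> precone_equiv G C" "(b, b) \<in> precone_equiv G C"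
    using precone_rel_refl assms unfolding precone_equiv_def by auto
  ultimately show ?thesis
    using assms by (auto simp: precone_chain_def simp flip: precone_rel_iff)
qed

lemma total_order_precone_chain:
  assumes "precone G C"
  shows "total_order (precone_chain G C)"
proof -
  have eq: "eq (precone_chain G C) = (=)" by (simp add: precone_chain_def)
  note rel = precone_rel_refl[OF assms] precone_rel_trans[OF assms] precone_rel_total[OF assms]
  have le: "precone_class G C a \<sqsubseteq>\<^bsub>precone_chain G C\<^esub> precone_class G C b \<longleftrightarrow>
      (a, b) \<in> precone_rel G C" if "a \<in> carrier G" "b \<in> carrier G" for a b
    using that by (simp add: precone_class_le_iff[OF assms])
  have refl: "X \<sqsubseteq>\<^bsub>precone_chain G C\<^esub> X" if "X \<in> carrier (precone_chain G C)" for X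
    using that rel(1) unfolding carrier_precone_chain by (auto simp: le simp del: precone_rel_iff)
  have antisym: "X = Y" if XY: "X \<in> carrier (precone_chain G C)" "Y \<in> carrier (precone_chain G C)"
    "X \<sqsubseteq>\<^bsub>precone_chain G C\<^esub> Y" "Y \<sqsubseteq>\<^bsub>precone_chain G C\<^esub> X" for X Y
  proof -
    obtain a b where "a \<in> carrier G" "X = precone_class G C a" "b \<in> carrier G" "Y = precone_class G C b"
      using XY(1,2) unfolding carrier_precone_chain by blast
    then show ?thesis
      using XY(3,4) by (simp add: precone_class_le_iff[OF assms] precone_class_eq_iff[OF assms])
  qed
  have trans: "X \<sqsubseteq>\<^bsub>precone_chain G C\<^esub> Z" if XYZ: "X \<in> carrier (precone_chain G C)"
    "Y \<in> carrier (precone_chain G C)" "Z \<in> carrier (precone_chain G C)"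
    "X \<sqsubseteq>\<^bsub>precone_chain G C\<^esub> Y" "Y \<sqsubseteq>\<^bsub>precone_chain G C\<^esub> Z" for X Y Z
  proof -
    obtain a b c where "a \<in> carrier G" "X = precone_class G C a" "b \<in> carrier G" "Y = precone_class G C b"
      "c \<in> carrier G" "Z = precone_class G C c"
      using XYZ(1-3) unfolding carrier_precone_chain by blast
    then show ?thesis
      using XYZ(4,5) rel(2)[of a b c] by (simp add: le del: precone_rel_iff)
  qed
  have total: "X \<sqsubseteq>\<^bsub>precone_chain G C\<^esub> Y \<or> Y \<sqsubseteq>\<^bsub>precone_chain G C\<^esub> X"
    if "X \<in> carrier (precone_chain G C)" "Y \<in> carrier (precone_chain G C)" for X Y
    using that rel(3) le unfolding carrier_precone_chain by blast
  show ?thesis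
  proof unfold_locales
    fix X Y Z
    assume "X \<in> carrier (precone_chain G C)" "Y \<in> carrier (precone_chain G C)"
      "Z \<in> carrier (precone_chain G C)"
      "X \<sqsubseteq>\<^bsub>precone_chain G C\<^esub> Y" "Y \<sqsubseteq>\<^bsub>precone_chain G C\<^esub> Z"
    then show "X \<sqsubseteq>\<^bsub>precone_chain G C\<^esub> Z" by (rule trans)
  next
    fix X Y
    assume "X \<sqsubseteq>\<^bsub>precone_chain G C\<^esub> Y" "Y \<sqsubseteq>\<^bsub>precone_chain G C\<^esub> X"
      "X \<in> carrier (precone_chain G C)" "Y \<in> carrier (precone_chain G C)"
    then show "X .=\<^bsub>precone_chain G C\<^esub> Y" using antisym[of X Y] by (simp add: eq)
  qed (simp_all add: eq refl total)
qed

text \<open>The definition unites the classes of all \<open>x \<otimes> a\<close> with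
  \<open>x\<close> equivalent to \<open>b\<close>. These classes coincide, since right
  multiplication respects the equivalence, and the family is nonempty because it includes
  \<open>b\<close>.\<close>

lemma right_translation_class:
  assumes "precone G C" "a \<in> carrier G" "b \<in> carrier G"
  shows "right_translation G C a (precone_class G C b) = precone_class G C (b \<otimes> a)"
proof -
  have "precone_class G C (x \<otimes> a) = precone_class G C (b \<otimes> a)" if "(b, x) \<in> precone_equiv G C" for x
  proof (rule sym, rule equiv_class_eq[OF equiv_precone_equiv[OF assms(1)]])
    have "x \<in> carrier G" using that precone_rel_carrier unfolding precone_equiv_def by blast
    then show "(b \<otimes> a, x \<otimes> a) \<in> precone_equiv G C"
      using that assms unfolding precone_equiv_def
      by (simp add: precone_rel_mult_right del: precone_rel_iff)
  qed
  moreover have "(b, b) \<in> precone_equiv G C"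
    using precone_rel_refl assms unfolding precone_equiv_def by simp
  ultimately have "(\<Union>x\<in>precone_class G C b. precone_class G C (x \<otimes> a)) = precone_class G C (b \<otimes> a)"
    by (intro UN_constant_eq[of b]) blast+
  then show ?thesis
    using assms by (simp add: right_translation_def precone_class_in_chain)
qed

lemma right_translation_closed:
  assumes "precone G C" "a \<in> carrier G"
  shows "right_translation G C a \<in> carrier (order_aut_group (precone_chain G C))"
proof (rule total_order.order_autI[OF total_order_precone_chain[OF assms(1)]])
  note rt = right_translation_class[OF assms]
  show "right_translation G C a \<in> extensional (carrier (precone_chain G C))"
    by (simp add: right_translation_def)
  have "x \<in> (\<lambda>b. b \<otimes> a) ` carrier G" if "x \<in> carrier G" for x
    using that assms by (intro image_eqI[of _ _ "x \<otimes> inv a"]) (simp_all add: m_assoc)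
  then have "(\<lambda>b. b \<otimes> a) ` carrier G = carrier G" using assms by auto
  moreover have "right_translation G C a ` carrier (precone_chain G C) =
      precone_class G C ` (\<lambda>b. b \<otimes> a) ` carrier G"
    unfolding carrier_precone_chain image_image by (rule image_cong) (simp_all only: rt)
  ultimately show "right_translation G C a ` carrier (precone_chain G C) = carrier (precone_chain G C)"
    by (simp only: carrier_precone_chain)
  fix X Y assume "X \<in> carrier (precone_chain G C)" "Y \<in> carrier (precone_chain G C)"
  then obtain x y where "x \<in> carrier G" "y \<in> carrier G" "X = precone_class G C x" "Y = precone_class G C y"
    unfolding carrier_precone_chain by blast
  then show "right_translation G C a X \<sqsubseteq>\<^bsub>precone_chain G C\<^esub> right_translation G C a Y \<longleftrightarrow>
      X \<sqsubseteq>\<^bsub>precone_chain G C\<^esub> Y"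
    using assms precone_rel_mult_right[of x y a C]
    by (simp add: rt precone_class_le_iff)
qed

lemma l_subgroup_precone_l_group:
  assumes "precone G C"
  shows "l_subgroup (carrier (precone_l_group G C)) (order_aut_group (precone_chain G C))"
  using right_translation_closed[OF assms]
  by (simp add: precone_l_group_def image_subset_iff
      total_order.l_subgroup_l_generate[OF total_order_precone_chain[OF assms]])

lemma precone_l_group_eq:
  "precone_l_group G C =
    (order_aut_group (precone_chain G C))\<lparr>carrier := carrier (precone_l_group G C)\<rparr>"
  by (simp add: precone_l_group_def)

lemma l_group_precone_l_group:
  assumes "precone G C"
  shows "l_group (precone_l_group G C)"
  using total_order.l_group_l_subgroup[OF total_order_precone_chain l_subgroup_precone_l_group, OF assms assms]
  by (simp flip: precone_l_group_eq)

end


section \<open>Limits of pre-cones\<close>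

text \<open>A set is identified with its characteristic function, hence with a point of a Cantor cube,
  in order to use the product topology of the library.\<close>

definition near :: "('a, 'b) pogroup_scheme \<Rightarrow> 'a set \<Rightarrow> 'a set filter"
  where "near G C = inf (filtermap Collect (nhds (\<lambda>x. x \<in> C))) (principal (Collect (precone G)))"

lemma eventually_near:
  "eventually P (near G C) \<longleftrightarrow>
    (\<forall>\<^sub>F p in nhds (\<lambda>x. x \<in> C). precone G (Collect p) \<longrightarrow> P (Collect p))"
  by (simp add: near_def eventually_inf_principal eventually_filtermap)

text \<open>Truth values carry the discrete topology, so every coordinate is locally
  constant.\<close>

lemma eventually_nhds_coordinate:
  fixes p :: "'a \<Rightarrow> bool"
  shows "\<forall>\<^sub>F q in nhds p. q a \<longleftrightarrow> p a"
proof -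
  have "open ((\<lambda>q :: 'a \<Rightarrow> bool. q a) -` {p a})"
    by (rule open_vimage[OF _ continuous_on_product_coordinates]) (rule open_discrete)
  then show ?thesis
    by (auto simp: eventually_nhds)
qed

lemma eventually_near_mem: "\<forall>\<^sub>F D in near G C. a \<in> D \<longleftrightarrow> a \<in> C"
  using eventually_nhds_coordinate[of a "\<lambda>x. x \<in> C"]
  by (auto simp: eventually_near elim: eventually_mono)

lemma eventually_near_precone: "\<forall>\<^sub>F D in near G C. precone G D"
  by (simp add: eventually_near)

text \<open>A point lies in all its neighbourhoods. This yields the value of a section at
  \<open>C\<close> itself from its description near \<open>C\<close>.\<close>

lemma eventually_near_self: "eventually P (near G C) \<Longrightarrow> precone G C \<Longrightarrow> P C"
  unfolding eventually_near using eventually_nhds_x_imp_x by fastforce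

text \<open>The element \<open>c\<close> is fixed before \<open>D\<close>, while the neighbourhood
  may depend on \<open>b\<close>: this is continuity with respect to pointwise convergence. Sections
  live on all pre-cones, so the notion does not involve a variety.\<close>

definition precone_section :: "('a, 'b) pogroup_scheme \<Rightarrow> ('a set \<Rightarrow> 'a set \<Rightarrow> 'a set) \<Rightarrow> bool"
  where "precone_section G \<phi> \<longleftrightarrow> (\<forall>C. precone G C \<longrightarrow>
    \<phi> C \<in> carrier (precone_l_group G C) \<and>
    (\<forall>b\<in>carrier G. \<exists>c\<in>carrier G.
      \<forall>\<^sub>F D in near G C. \<phi> D (precone_class G D b) = precone_class G D c))"

lemma precone_section_closed:
  "precone_section G \<phi> \<Longrightarrow> precone G C \<Longrightarrow> \<phi> C \<in> carrier (precone_l_group G C)"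
  by (simp add: precone_section_def)

lemma precone_sectionE:
  assumes "precone_section G \<phi>" "precone G C" "b \<in> carrier G"
  obtains c where "c \<in> carrier G"
    "\<forall>\<^sub>F D in near G C. \<phi> D (precone_class G D b) = precone_class G D c"
    "\<phi> C (precone_class G C b) = precone_class G C c"
proof -
  obtain c where c: "c \<in> carrier G"
    "\<forall>\<^sub>F D in near G C. \<phi> D (precone_class G D b) = precone_class G D c"
    using assms unfolding precone_section_def by blast
  then show ?thesis using that eventually_near_self[OF c(2) assms(2)] by blast
qed

lemma precone_sectionI:
  assumes "\<And>C. precone G C \<Longrightarrow> \<phi> C \<in> carrier (precone_l_group G C)"
    and "\<And>C b. precone G C \<Longrightarrow> b \<in> carrier G \<Longrightarrow> \<exists>c\<in>carrier G.
      \<forall>\<^sub>F D in near G C. \<phi> D (precone_class G D b) = precone_class G D c"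
  shows "precone_section G \<phi>"
  using assms by (simp add: precone_section_def)

section \<open>Closure of the sections under the operations of \<ell>-groups\<close>

context po_group
begin

lemma precone_l_group_subset:
  assumes "precone G C"
  shows "carrier (precone_l_group G C) \<subseteq> carrier (order_aut_group (precone_chain G C))"
  using l_subgroup_precone_l_group[OF assms] unfolding l_subgroup_def by (blast dest: subgroup.subset)

lemma right_translation_in_l_group:
  assumes "a \<in> carrier G"
  shows "right_translation G C a \<in> carrier (precone_l_group G C)"
  using assms by (auto simp: precone_l_group_def l_generate_def)

lemma precone_l_group_simps [simp]:
  "f \<otimes>\<^bsub>precone_l_group G C\<^esub> g = compose (carrier (precone_chain G C)) g f"
  "\<one>\<^bsub>precone_l_group G C\<^esub> = (\<lambda>X\<in>carrier (precone_chain G C). X)"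
  by (simp_all add: precone_l_group_def)

lemma group_precone_l_group: "precone G C \<Longrightarrow> group (precone_l_group G C)"
  using l_group_precone_l_group unfolding l_group_def po_group_def by blast

text \<open>The inverse is defined relative to the carrier, so it has to be compared with the one in
  the full automorphism group. As the product is taken in reversed order, the law of right inverses
  says that applying the inverse after \<open>f\<close> gives the identity.\<close>

lemma precone_l_group_inv:
  assumes "precone G C" "f \<in> carrier (precone_l_group G C)"
  shows "inv\<^bsub>precone_l_group G C\<^esub> f = inv\<^bsub>order_aut_group (precone_chain G C)\<^esub> f"
    and "X \<in> carrier (precone_chain G C) \<Longrightarrow> (inv\<^bsub>precone_l_group G C\<^esub> f) (f X) = X"
proof -
  have sub: "subgroup (carrier (precone_l_group G C)) (order_aut_group (precone_chain G C))"
    using l_subgroup_precone_l_group[OF assms(1)] by (simp add: l_subgroup_def)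
  show "inv\<^bsub>precone_l_group G C\<^esub> f = inv\<^bsub>order_aut_group (precone_chain G C)\<^esub> f"
    by (subst precone_l_group_eq)
      (rule group.m_inv_consistent[OF total_order.group_order_aut_group[OF total_order_precone_chain[OF assms(1)]] sub assms(2)])
  assume X: "X \<in> carrier (precone_chain G C)"
  have "f \<otimes>\<^bsub>precone_l_group G C\<^esub> inv\<^bsub>precone_l_group G C\<^esub> f = \<one>\<^bsub>precone_l_group G C\<^esub>"
    using group.r_inv[OF group_precone_l_group] assms by blast
  then have "compose (carrier (precone_chain G C)) (inv\<^bsub>precone_l_group G C\<^esub> f) f X = X"
    using X by simp
  then show "(inv\<^bsub>precone_l_group G C\<^esub> f) (f X) = X"
    using X by (simp add: compose_def)
qed

lemma precone_l_group_join_meet: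
  assumes "precone G C" "f \<in> carrier (precone_l_group G C)" "g \<in> carrier (precone_l_group G C)"
  shows "gjoin (precone_l_group G C) f g = aut_max (precone_chain G C) f g"
    and "gmeet (precone_l_group G C) f g = aut_min (precone_chain G C) f g"
    and "aut_max (precone_chain G C) f g \<in> carrier (precone_l_group G C)"
    and "aut_min (precone_chain G C) f g \<in> carrier (precone_l_group G C)"
proof -
  interpret W: total_order "precone_chain G C" by (rule total_order_precone_chain[OF assms(1)])
  show *: "aut_max (precone_chain G C) f g \<in> carrier (precone_l_group G C)"
    "aut_min (precone_chain G C) f g \<in> carrier (precone_l_group G C)"
    using l_subgroup_precone_l_group[OF assms(1)] assms(2,3)
    unfolding W.l_subgroup_order_aut_group_iff by blast+
  show "gjoin (precone_l_group G C) f g = aut_max (precone_chain G C) f g"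
    using W.aut_join(2)[OF precone_l_group_subset[OF assms(1)] assms(2,3) *(1)]
    by (simp flip: precone_l_group_eq)
  show "gmeet (precone_l_group G C) f g = aut_min (precone_chain G C) f g"
    using W.aut_meet(2)[OF precone_l_group_subset[OF assms(1)] assms(2,3) *(2)]
    by (simp flip: precone_l_group_eq)
qed

text \<open>Equality of the two classes is decided by two coordinates of the pre-cone, the
  memberships of \<open>b \<otimes> inv a\<close> and \<open>a \<otimes> inv b\<close>.\<close>

lemma eventually_near_class_eq:
  assumes "precone G C" "a \<in> carrier G" "b \<in> carrier G"
  shows "\<forall>\<^sub>F D in near G C. precone_class G D a = precone_class G D b \<longleftrightarrow>
    precone_class G C a = precone_class G C b"
  using eventually_near_mem[of "b \<otimes> inv a" C G] eventually_near_mem[of "a \<otimes> inv b" C G]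
    eventually_near_precone[of G C]
  by eventually_elim (simp add: precone_class_eq_iff assms)

lemma eventually_near_class_le:
  assumes "precone G C" "a \<in> carrier G" "b \<in> carrier G"
  shows "\<forall>\<^sub>F D in near G C.
    precone_class G D a \<sqsubseteq>\<^bsub>precone_chain G D\<^esub> precone_class G D b \<longleftrightarrow>
    precone_class G C a \<sqsubseteq>\<^bsub>precone_chain G C\<^esub> precone_class G C b"
  using eventually_near_mem[of "b \<otimes> inv a" C G] eventually_near_precone[of G C]
  by eventually_elim (simp add: precone_class_le_iff assms)

lemma precone_section_right_translation:
  assumes "a \<in> carrier G"
  shows "precone_section G (\<lambda>C. right_translation G C a)"
proof (rule precone_sectionI)
  fix C b assume "precone G C" "b \<in> carrier G"
  have "\<forall>\<^sub>F D in near G C. right_translation G D a (precone_class G D b) = precone_class G D (b \<otimes> a)"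
    using eventually_near_precone[of G C]
    by eventually_elim (simp add: right_translation_class assms \<open>b \<in> carrier G\<close>)
  then show "\<exists>c\<in>carrier G. \<forall>\<^sub>F D in near G C.
      right_translation G D a (precone_class G D b) = precone_class G D c"
    using assms \<open>b \<in> carrier G\<close> by blast
qed (rule right_translation_in_l_group[OF assms])

lemma precone_section_one: "precone_section G (\<lambda>C. \<one>\<^bsub>precone_l_group G C\<^esub>)"
proof (rule precone_sectionI)
  fix C b assume "precone G C" "b \<in> carrier G"
  then show "\<exists>c\<in>carrier G. \<forall>\<^sub>F D in near G C.
      \<one>\<^bsub>precone_l_group G D\<^esub> (precone_class G D b) = precone_class G D c"
    by (intro bexI[of _ b]) (simp_all add: precone_class_in_chain)
qed (rule monoid.one_closed[OF group.is_monoid[OF group_precone_l_group]])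

lemma precone_section_mult:
  assumes "precone_section G \<phi>" "precone_section G \<psi>"
  shows "precone_section G (\<lambda>C. \<phi> C \<otimes>\<^bsub>precone_l_group G C\<^esub> \<psi> C)"
proof (rule precone_sectionI)
  fix C assume C: "precone G C"
  show "\<phi> C \<otimes>\<^bsub>precone_l_group G C\<^esub> \<psi> C \<in> carrier (precone_l_group G C)"
    using monoid.m_closed[OF group.is_monoid[OF group_precone_l_group[OF C]]]
      precone_section_closed[OF _ C] assms by blast
  fix b assume b: "b \<in> carrier G"
  obtain c where c: "c \<in> carrier G"
    "\<forall>\<^sub>F D in near G C. \<phi> D (precone_class G D b) = precone_class G D c"
    using assms(1) C b by (rule precone_sectionE)
  \<comment> \<open>The product applies \<open>\<psi>\<close> after \<open>\<phi>\<close>, so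
    \<open>\<psi>\<close> is examined at the representative \<open>c\<close> just found for
    \<open>\<phi>\<close>.\<close>
  obtain d where d: "d \<in> carrier G"
    "\<forall>\<^sub>F D in near G C. \<psi> D (precone_class G D c) = precone_class G D d"
    using assms(2) C c(1) by (rule precone_sectionE)
  have "\<forall>\<^sub>F D in near G C. (\<phi> D \<otimes>\<^bsub>precone_l_group G D\<^esub> \<psi> D) (precone_class G D b) = precone_class G D d"
    using c(2) d(2) by eventually_elim (simp add: compose_def precone_class_in_chain b)
  then show "\<exists>d\<in>carrier G. \<forall>\<^sub>F D in near G C.
      (\<phi> D \<otimes>\<^bsub>precone_l_group G D\<^esub> \<psi> D) (precone_class G D b) = precone_class G D d"
    using d(1) by blast
qed

text \<open>By surjectivity some class of \<open>c\<close> is sent to that of \<open>b\<close> at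
  \<open>C\<close>. Near \<open>C\<close> the image of the class of \<open>c\<close> is represented
  by a fixed \<open>d\<close>, which is equivalent to \<open>b\<close> at \<open>C\<close> and hence
  near \<open>C\<close>. So the inverse takes the class of \<open>b\<close> to that of
  \<open>c\<close> throughout a neighbourhood.\<close>

lemma precone_section_inv:
  assumes "precone_section G \<phi>"
  shows "precone_section G (\<lambda>C. inv\<^bsub>precone_l_group G C\<^esub> \<phi> C)"
proof (rule precone_sectionI)
  fix C assume C: "precone G C"
  note f = precone_section_closed[OF assms C]
  show "inv\<^bsub>precone_l_group G C\<^esub> \<phi> C \<in> carrier (precone_l_group G C)"
    by (rule group.inv_closed[OF group_precone_l_group[OF C] f])
  fix b assume b: "b \<in> carrier G"
  have "\<phi> C ` carrier (precone_chain G C) = carrier (precone_chain G C)"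
    using total_order.order_autD(2)[OF total_order_precone_chain[OF C]] f
      precone_l_group_subset[OF C] by blast
  then have "precone_class G C b \<in> \<phi> C ` precone_class G C ` carrier G"
    using b by (simp add: carrier_precone_chain)
  then obtain c where c: "c \<in> carrier G" "\<phi> C (precone_class G C c) = precone_class G C b"
    by force
  obtain d where d: "d \<in> carrier G"
    "\<forall>\<^sub>F D in near G C. \<phi> D (precone_class G D c) = precone_class G D d"
    "\<phi> C (precone_class G C c) = precone_class G C d"
    using assms C c(1) by (rule precone_sectionE)
  have "\<forall>\<^sub>F D in near G C.
      (inv\<^bsub>precone_l_group G D\<^esub> \<phi> D) (precone_class G D b) = precone_class G D c"
    using d(2) eventually_near_class_eq[OF C b d(1)] eventually_near_precone[of G C]
  proof eventually_elim
    case (elim D)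
    then have "precone_class G D b = \<phi> D (precone_class G D c)" using c(2) d(3) by simp
    then show ?case
      using precone_l_group_inv(2)[OF elim(3) precone_section_closed[OF assms elim(3)]]
        precone_class_in_chain[OF c(1)] by simp
  qed
  then show "\<exists>c\<in>carrier G. \<forall>\<^sub>F D in near G C.
      (inv\<^bsub>precone_l_group G D\<^esub> \<phi> D) (precone_class G D b) = precone_class G D c"
    using c(1) by blast
qed

lemma precone_section_join_meet:
  assumes "precone_section G \<phi>" "precone_section G \<psi>"
  shows "precone_section G (\<lambda>C. gjoin (precone_l_group G C) (\<phi> C) (\<psi> C))"
    and "precone_section G (\<lambda>C. gmeet (precone_l_group G C) (\<phi> C) (\<psi> C))"
proof -
  have jm: "gjoin (precone_l_group G C) (\<phi> C) (\<psi> C) = aut_max (precone_chain G C) (\<phi> C) (\<psi> C)"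
      "gmeet (precone_l_group G C) (\<phi> C) (\<psi> C) = aut_min (precone_chain G C) (\<phi> C) (\<psi> C)"
      "aut_max (precone_chain G C) (\<phi> C) (\<psi> C) \<in> carrier (precone_l_group G C)"
      "aut_min (precone_chain G C) (\<phi> C) (\<psi> C) \<in> carrier (precone_l_group G C)"
    if "precone G C" for C
    using precone_l_group_join_meet[OF that precone_section_closed[OF assms(1) that]
        precone_section_closed[OF assms(2) that]] .
  have "(\<exists>e\<in>carrier G. \<forall>\<^sub>F D in near G C.
      gjoin (precone_l_group G D) (\<phi> D) (\<psi> D) (precone_class G D b) = precone_class G D e) \<and>
    (\<exists>e\<in>carrier G. \<forall>\<^sub>F D in near G C.
      gmeet (precone_l_group G D) (\<phi> D) (\<psi> D) (precone_class G D b) = precone_class G D e)"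
    if C: "precone G C" and b: "b \<in> carrier G" for C b
  proof -
    obtain c where c: "c \<in> carrier G"
      "\<forall>\<^sub>F D in near G C. \<phi> D (precone_class G D b) = precone_class G D c"
      using assms(1) C b by (rule precone_sectionE)
    obtain d where d: "d \<in> carrier G"
      "\<forall>\<^sub>F D in near G C. \<psi> D (precone_class G D b) = precone_class G D d"
      using assms(2) C b by (rule precone_sectionE)
    \<comment> \<open>The comparison is made once, at \<open>C\<close>, so that the chosen
      representative does not depend on \<open>D\<close>. Its outcome is the same for all pre-cones
      near \<open>C\<close>.\<close>
    let ?le = "\<lambda>a b. precone_class G C a \<sqsubseteq>\<^bsub>precone_chain G C\<^esub> precone_class G C b"
    have "\<forall>\<^sub>F D in near G C. gjoin (precone_l_group G D) (\<phi> D) (\<psi> D) (precone_class G D b) =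
        precone_class G D (if ?le c d then d else c)"
      using c(2) d(2) eventually_near_class_le[OF C c(1) d(1)] eventually_near_precone[of G C]
      by eventually_elim (simp add: jm aut_max_def precone_class_in_chain b)
    moreover have "\<forall>\<^sub>F D in near G C. gmeet (precone_l_group G D) (\<phi> D) (\<psi> D) (precone_class G D b) =
        precone_class G D (if ?le d c then d else c)"
      using c(2) d(2) eventually_near_class_le[OF C d(1) c(1)] eventually_near_precone[of G C]
      by eventually_elim (simp add: jm aut_min_def precone_class_in_chain b)
    moreover have "(if P then c else d) \<in> carrier G" "(if P then d else c) \<in> carrier G" for P
      using c(1) d(1) by simp_all
    ultimately show ?thesis by blast
  qed
  then show "precone_section G (\<lambda>C. gjoin (precone_l_group G C) (\<phi> C) (\<psi> C))"
    "precone_section G (\<lambda>C. gmeet (precone_l_group G C) (\<phi> C) (\<psi> C))"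
    by (simp_all add: precone_section_def jm)
qed

lemma precone_section_lterm_eval:
  assumes "\<And>n. precone_section G (\<phi> n)"
  shows "precone_section G (\<lambda>C. lterm_eval (precone_l_group G C) (\<lambda>n. \<phi> n C) t)"
proof (induction t)
  case One
  show ?case unfolding lterm_eval.simps by (rule precone_section_one)
next
  case (Inv t)
  then show ?case unfolding lterm_eval.simps by (rule precone_section_inv)
next
  case (Mult s t)
  then show ?case unfolding lterm_eval.simps by (rule precone_section_mult)
next
  case (Join s t)
  then show ?case unfolding lterm_eval.simps by (rule precone_section_join_meet)
next
  case (Meet s t)
  then show ?case unfolding lterm_eval.simps by (rule precone_section_join_meet)
qed (simp add: assms)

lemma precone_section_surj:
  assumes C: "precone G C" and f: "f \<in> carrier (precone_l_group G C)"
  obtains \<phi> where "precone_section G \<phi>" "\<phi> C = f"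
proof -
  interpret W: total_order "precone_chain G C" by (rule total_order_precone_chain[OF C])
  let ?A = "order_aut_group (precone_chain G C)"
  \<comment> \<open>The values at \<open>C\<close> of all sections. As the generated \<ell>-subgroup
    is the least one containing the translations, it suffices that \<open>S\<close> is an
    \<ell>-subgroup containing them.\<close>
  define S where "S = (\<lambda>\<phi>. \<phi> C) ` Collect (precone_section G)"
  have S: "S \<subseteq> carrier ?A"
    using precone_section_closed[OF _ C] precone_l_group_subset[OF C] by (auto simp: S_def)
  have "l_subgroup S ?A"
    unfolding W.l_subgroup_order_aut_group_iff
  proof (intro conjI ballI group.subgroupI[OF W.group_order_aut_group] S)
    show "S \<noteq> {}" using precone_section_one by (auto simp: S_def)
  next
    fix g assume "g \<in> S"
    then obtain \<phi> where \<phi>: "precone_section G \<phi>" "g = \<phi> C" by (auto simp: S_def)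
    show "inv\<^bsub>?A\<^esub> g \<in> S"
      using precone_section_inv[OF \<phi>(1)]
        precone_l_group_inv(1)[OF C precone_section_closed[OF \<phi>(1) C]]
      unfolding S_def \<phi>(2) by (metis (no_types, lifting) image_eqI mem_Collect_eq)
  next
    fix g h assume "g \<in> S" "h \<in> S"
    then obtain \<phi> \<psi> where \<phi>: "precone_section G \<phi>" "g = \<phi> C" and \<psi>: "precone_section G \<psi>" "h = \<psi> C"
      by (auto simp: S_def)
    note jm = precone_l_group_join_meet[OF C precone_section_closed[OF \<phi>(1) C] precone_section_closed[OF \<psi>(1) C]]
    show "g \<otimes>\<^bsub>?A\<^esub> h \<in> S"
      using precone_section_mult[OF \<phi>(1) \<psi>(1)]
      unfolding S_def \<phi>(2) \<psi>(2) by (intro image_eqI) auto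
    show "aut_max (precone_chain G C) g h \<in> S"
      using precone_section_join_meet(1)[OF \<phi>(1) \<psi>(1)] jm(1)
      unfolding S_def \<phi>(2) \<psi>(2) by (intro image_eqI) auto
    show "aut_min (precone_chain G C) g h \<in> S"
      using precone_section_join_meet(2)[OF \<phi>(1) \<psi>(1)] jm(2)
      unfolding S_def \<phi>(2) \<psi>(2) by (intro image_eqI) auto
  qed
  moreover have "right_translation G C ` carrier G \<subseteq> S"
    using precone_section_right_translation unfolding S_def by force
  ultimately have "carrier (precone_l_group G C) \<subseteq> S"
    by (auto simp: precone_l_group_def l_generate_def)
  then show ?thesis using f that by (auto simp: S_def)
qed

end

section \<open>Membership in the variety as a closed condition in the Cantor cube\<close>

lemma eventually_nhds_bool_fun_iff:
  fixes p :: "'a \<Rightarrow> bool"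
  shows "eventually P (nhds p) \<longleftrightarrow> (\<exists>E. finite E \<and> (\<forall>q. (\<forall>x\<in>E. q x = p x) \<longrightarrow> P q))"
proof
  assume "eventually P (nhds p)"
  then obtain U where U: "open U" "p \<in> U" "\<And>q. q \<in> U \<Longrightarrow> P q"
    by (auto simp: eventually_nhds)
  then have "openin (product_topology (\<lambda>_. euclidean) UNIV) U" by (simp add: open_fun_def)
  \<comment> \<open>A basic open box constrains only the finitely many coordinates whose factor is
    not the whole space. Agreement with \<open>p\<close> on these keeps a point inside the
    box.\<close>
  then obtain B where B: "finite {i. B i \<noteq> (UNIV :: bool set)}" "p \<in> Pi\<^sub>E UNIV B" "Pi\<^sub>E UNIV B \<subseteq> U"
    using U(2) unfolding openin_product_topology_alt by auto
  have "P q" if q: "\<forall>x\<in>{i. B i \<noteq> UNIV}. q x = p x" for q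
  proof -
    have "q x \<in> B x" for x
      using q B(2) by (cases "B x = UNIV") auto
    then show ?thesis using B(3) U(3) by blast
  qed
  with B(1) show "\<exists>E. finite E \<and> (\<forall>q. (\<forall>x\<in>E. q x = p x) \<longrightarrow> P q)" by blast
next
  assume "\<exists>E. finite E \<and> (\<forall>q. (\<forall>x\<in>E. q x = p x) \<longrightarrow> P q)"
  then obtain E where "finite E" "\<And>q. \<forall>x\<in>E. q x = p x \<Longrightarrow> P q" by blast
  moreover have "\<forall>\<^sub>F q in nhds p. \<forall>x\<in>E. q x = p x"
    using \<open>finite E\<close> by (rule eventually_ball_finite) (simp add: eventually_nhds_coordinate)
  ultimately show "eventually P (nhds p)" by (auto elim: eventually_mono)
qed

text \<open>Tychonoff's theorem for powers of the two-point space.\<close>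

lemma compact_UNIV_bool_fun: "compact (UNIV :: ('a \<Rightarrow> bool) set)"
proof -
  have "compact_space (product_topology (\<lambda>_ :: 'a. euclidean :: bool topology) UNIV)"
    by (rule compact_space_product_topology[THEN iffD2])
      (simp add: compact_space_def finite_imp_compact)
  then show ?thesis
    by (simp add: euclidean_product_topology compact_space_def)
qed

text \<open>The assumption \<open>approx\<close> puts \<open>C\<close> into the closure of the space
  in the Cantor cube. Each closure property of pre-cones concerns at most three elements of the
  group at a time and so passes to \<open>C\<close>. Properness does not pass to limits, whence the
  assumption \<open>ne\<close>.\<close>

lemma (in po_group) precones_limit:
  assumes V: "l_group_variety V" and ne: "C \<noteq> carrier G"
    and approx: "\<And>E. finite E \<Longrightarrow> \<exists>D\<in>precones V G. \<forall>x\<in>E. x \<in> D \<longleftrightarrow> x \<in> C"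
  shows "C \<in> precones V G"
proof -
  have approx': "\<exists>D. precone G D \<and> (\<forall>x\<in>E. x \<in> D \<longleftrightarrow> x \<in> C)" if "finite E" for E
    using approx[OF that] by (auto simp: precones_def)
  have sub: "C \<subseteq> carrier G"
  proof
    fix x assume "x \<in> C"
    then show "x \<in> carrier G" using approx'[of "{x}"] precone_subset by auto
  qed
  have "\<one> \<in> C"
    using approx'[of "{\<one>}"] preconeD(1) by auto
  moreover have "x \<otimes> y \<in> C" if "x \<in> C" "y \<in> C" for x y
    using approx'[of "{x, y, x \<otimes> y}"] preconeD(2) that by auto
  ultimately have "submonoid C G" using sub by (simp add: submonoid.intro)
  moreover have "x \<in> C" if "x \<in> carrier G" "\<one> \<preceq> x" for x
    using approx'[of "{x}"] preconeD(5) that by auto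
  moreover have "x \<in> C \<or> inv x \<in> C" if "x \<in> carrier G" for x
    using approx'[of "{x, inv x}"] preconeD(4) that by auto
  then have "x \<in> C \<union> m_inv G ` C" if "x \<in> carrier G" for x
    using that by (metis UnCI image_eqI inv_inv)
  then have "carrier G = C \<union> m_inv G ` C" using sub by auto
  ultimately have C: "precone G C"
    using ne unfolding precone_iff by blast
  obtain \<E> where \<E>: "V = {L. l_group L \<and> (\<forall>e\<in>\<E>. satisfies L e)}"
    using V unfolding l_group_variety_def by blast
  have "satisfies (precone_l_group G C) (s, t)" if st: "(s, t) \<in> \<E>" for s t
    unfolding satisfies_def prod.case
  proof (intro allI impI)
    fix v :: "nat \<Rightarrow> 'a set \<Rightarrow> 'a set"
    assume v: "range v \<subseteq> carrier (precone_l_group G C)"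
    \<comment> \<open>Extending the valuation at \<open>C\<close> to sections allows both sides of
      the equation to be evaluated at nearby pre-cones as well.\<close>
    have "\<exists>\<phi>. precone_section G \<phi> \<and> \<phi> C = v n" for n
      using precone_section_surj[OF C, of "v n"] v by (metis rangeI subsetD)
    then obtain \<phi> where \<phi>: "\<And>n. precone_section G (\<phi> n)" "\<And>n. \<phi> n C = v n" by metis
    define \<sigma> \<tau> where "\<sigma> = (\<lambda>C. lterm_eval (precone_l_group G C) (\<lambda>n. \<phi> n C) s)"
      and "\<tau> = (\<lambda>C. lterm_eval (precone_l_group G C) (\<lambda>n. \<phi> n C) t)"
    have \<sigma>: "precone_section G \<sigma>" and \<tau>: "precone_section G \<tau>"
      unfolding \<sigma>_def \<tau>_def using \<phi>(1) by (rule precone_section_lterm_eval)+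
    have eq: "\<sigma> D = \<tau> D" if "D \<in> precones V G" for D
    proof -
      have "satisfies (precone_l_group G D) (s, t)" "precone G D"
        using that st unfolding precones_def \<E> by auto
      moreover from this(2) have "range (\<lambda>n. \<phi> n D) \<subseteq> carrier (precone_l_group G D)"
        using precone_section_closed[OF \<phi>(1)] by blast
      ultimately show ?thesis
        unfolding satisfies_def \<sigma>_def \<tau>_def by simp
    qed
    have "\<sigma> C = \<tau> C"
    proof (rule total_order.order_aut_eqI[OF total_order_precone_chain[OF C]])
      show "\<sigma> C \<in> carrier (order_aut_group (precone_chain G C))"
        "\<tau> C \<in> carrier (order_aut_group (precone_chain G C))"
        using precone_section_closed[OF _ C] \<sigma> \<tau> precone_l_group_subset[OF C] by blast+
      fix X assume "X \<in> carrier (precone_chain G C)"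
      then obtain b where b: "b \<in> carrier G" "X = precone_class G C b"
        unfolding carrier_precone_chain by blast
      obtain c where c: "c \<in> carrier G" "\<sigma> C X = precone_class G C c"
        "\<forall>\<^sub>F D in near G C. \<sigma> D (precone_class G D b) = precone_class G D c"
        using \<sigma> C b(1) unfolding b(2) by (rule precone_sectionE)
      obtain d where d: "d \<in> carrier G" "\<tau> C X = precone_class G C d"
        "\<forall>\<^sub>F D in near G C. \<tau> D (precone_class G D b) = precone_class G D d"
        using \<tau> C b(1) unfolding b(2) by (rule precone_sectionE)
      from c(3) d(3) eventually_near_class_eq[OF C c(1) d(1)]
      \<comment> \<open>The conclusion no longer mentions \<open>D\<close>. Hence a single
        \<open>D\<close> in the space that agrees with \<open>C\<close> on a suitable finite set
        proves it, since the two sections coincide at \<open>D\<close>.\<close>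
      have "\<forall>\<^sub>F D in near G C. \<sigma> D = \<tau> D \<longrightarrow> precone_class G C c = precone_class G C d"
        by eventually_elim auto
      then obtain E where E: "finite E" and agree: "\<And>p. \<forall>x\<in>E. p x = (x \<in> C) \<Longrightarrow>
          precone G (Collect p) \<Longrightarrow> \<sigma> (Collect p) = \<tau> (Collect p) \<Longrightarrow>
          precone_class G C c = precone_class G C d"
        unfolding eventually_near eventually_nhds_bool_fun_iff by blast
      obtain D where "D \<in> precones V G" "\<forall>x\<in>E. x \<in> D \<longleftrightarrow> x \<in> C"
        using approx[OF E] by blast
      then have "precone_class G C c = precone_class G C d"
        using agree[of "\<lambda>x. x \<in> D"] eq[of D] by (simp add: precones_def)
      then show "\<sigma> C X = \<tau> C X" using c(2) d(2) by simp
    qed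
    then show "lterm_eval (precone_l_group G C) v s = lterm_eval (precone_l_group G C) v t"
      by (simp add: \<sigma>_def \<tau>_def \<phi>(2))
  qed
  then have "precone_l_group G C \<in> V"
    unfolding \<E> using l_group_precone_l_group[OF C] by auto
  then show ?thesis using C by (simp add: precones_def)
qed


section \<open>The topology of the space of right pre-orders\<close>

text \<open>For finite nonempty \<open>F\<close> inside the group these are the finite intersections
  of the sets \<open>precone_basic V G a\<close>, indexed so that intersections correspond to unions
  of index sets.\<close>

definition precones_avoiding ::
    "('a set \<Rightarrow> 'a set) pogroup set \<Rightarrow> ('a, 'b) pogroup_scheme \<Rightarrow> 'a set \<Rightarrow> 'a set set"
  where "precones_avoiding V G F = {C \<in> precones V G. C \<inter> F = {}}"

lemma precones_avoiding_Un:
  "precones_avoiding V G (E \<union> F) = precones_avoiding V G E \<inter> precones_avoiding V G F"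
  by (auto simp: precones_avoiding_def)

section \<open>The base, compactness and sobriety\<close>

context po_group
begin

text \<open>A pre-cone without the inverse of \<open>a\<close> must contain \<open>a\<close> by
  totality.\<close>

lemma precone_basic_eq_avoiding:
  "a \<in> carrier G \<Longrightarrow> precone_basic V G a = precones_avoiding V G {inv a}"
  using preconeD(4) by (fastforce simp: precone_basic_def precones_avoiding_def precones_def)

lemma openin_precones_avoiding:
  assumes "finite F" "F \<subseteq> carrier G"
  shows "openin (precone_space V G) (precones_avoiding V G F)"
  using assms
proof (induction F rule: finite_induct)
  case empty
  then show ?case
    using openin_topspace[of "precone_space V G"] by (simp add: precones_avoiding_def)
next
  case (insert a F)
  then have "precones_avoiding V G {a} = precone_basic V G (inv a)"
    by (simp add: precone_basic_eq_avoiding)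
  then have "openin (precone_space V G) (precones_avoiding V G {a})"
    using insert.prems by (simp add: precone_space_def topology_generated_by_Basis)
  then show ?case
    using insert precones_avoiding_Un[of V G "{a}" F] by (simp add: openin_Int)
qed

text \<open>The nonemptiness of \<open>F\<close> is part of the claim because compactness of the
  basic sets is only established for nonempty \<open>F\<close>.\<close>

lemma precones_avoiding_base:
  assumes "openin (precone_space V G) U" "C \<in> U"
  obtains F where "finite F" "F \<noteq> {}" "F \<subseteq> carrier G"
    "C \<in> precones_avoiding V G F" "precones_avoiding V G F \<subseteq> U"
proof -
  have "generate_topology_on (insert (precones V G) (precone_basic V G ` carrier G)) U"
    using assms(1) by (simp add: precone_space_def openin_topology_generated_by_iff)
  then have "C \<in> U \<Longrightarrow> \<exists>F. finite F \<and> F \<noteq> {} \<and> F \<subseteq> carrier G \<and>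
      C \<in> precones_avoiding V G F \<and> precones_avoiding V G F \<subseteq> U"
  proof induction
    case (Int U W)
    then obtain E F where "finite E" "E \<noteq> {}" "E \<subseteq> carrier G"
      "C \<in> precones_avoiding V G E" "precones_avoiding V G E \<subseteq> U"
      "finite F" "F \<subseteq> carrier G" "C \<in> precones_avoiding V G F" "precones_avoiding V G F \<subseteq> W"
      by blast
    then show ?case
      by (intro exI[of _ "E \<union> F"]) (auto simp: precones_avoiding_Un)
  next
    case (UN K)
    then obtain U where "U \<in> K" "C \<in> U" by blast
    with UN.IH[of U] show ?case by blast
  next
    case (Basis U)
    then consider "U = precones V G" | a where "a \<in> carrier G" "U = precone_basic V G a"
      by blast
    then show ?case
    proof cases
      case 1
      then have "precone G C" using Basis.prems by (simp add: precones_def)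
      \<comment> \<open>Around each point even the whole space contains a basic set with nonempty
        index set: a pre-cone is proper and so omits some \<open>a\<close>.\<close>
      then obtain a where "a \<in> carrier G" "a \<notin> C"
        using precone_subset preconeD(3) by blast
      then show ?thesis
        using 1 Basis.prems by (intro exI[of _ "{a}"]) (auto simp: precones_avoiding_def)
    next
      case 2
      then show ?thesis
        using Basis.prems by (intro exI[of _ "{inv a}"]) (simp add: precone_basic_eq_avoiding)
    qed
  qed simp
  then show ?thesis using assms(2) that by blast
qed

text \<open>The corresponding set \<open>K\<close> of characteristic functions is closed in the
  compact Cantor cube, and \<open>Collect\<close> maps it continuously onto the set in
  question.\<close>

lemma compactin_precones_avoiding:
  assumes V: "l_group_variety V" and F: "F \<noteq> {}" "F \<subseteq> carrier G"
  shows "compactin (precone_space V G) (precones_avoiding V G F)"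
proof -
  define K where "K = {p. Collect p \<in> precones_avoiding V G F}"
  have "open (- K)"
  proof (rule openI, rule ccontr)
    fix p assume p: "p \<in> - K" and "\<not> (\<exists>T. open T \<and> p \<in> T \<and> T \<subseteq> - K)"
    then have "\<not> (\<forall>\<^sub>F q in nhds p. q \<notin> K)" by (auto simp: eventually_nhds subset_iff)
    \<comment> \<open>Thus \<open>p\<close> is a limit of \<open>K\<close>: it agrees with members
      of \<open>K\<close> on every finite set.\<close>
    then have K: "\<exists>q\<in>K. \<forall>x\<in>E. q x = p x" if "finite E" for E
      using that unfolding eventually_nhds_bool_fun_iff by blast
    have "\<not> p x" if "x \<in> F" for x
      using K[of "{x}"] that by (auto simp: K_def precones_avoiding_def)
    then have pF: "Collect p \<inter> F = {}" by blast
    have "Collect p \<in> precones V G"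
    proof (rule precones_limit[OF V])
      \<comment> \<open>Here \<open>F\<close> must be nonempty: the limit still avoids
        \<open>F\<close>, so it cannot be all of the group.\<close>
      show "Collect p \<noteq> carrier G" using pF F by blast
      fix E :: "'a set" assume "finite E"
      then show "\<exists>D\<in>precones V G. \<forall>x\<in>E. x \<in> D \<longleftrightarrow> x \<in> Collect p"
        using K[of E] by (fastforce simp: K_def precones_avoiding_def)
    qed
    with pF p show False by (simp add: K_def precones_avoiding_def)
  qed
  then have "compact K"
    using compact_Int_closed[OF compact_UNIV_bool_fun, of K] by (simp add: closed_def)
  \<comment> \<open>The cube topology treats membership and non-membership alike, so the conditions
    on \<open>a\<close> and on its inverse in a subbasic set are open in it.\<close>
  moreover have "continuous_map (top_of_set K) (precone_space V G) Collect"
    unfolding precone_space_def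
  proof (rule continuous_on_generated_topo)
    fix U assume "U \<in> insert (precones V G) (precone_basic V G ` carrier G)"
    then consider "U = precones V G" | a where "U = precone_basic V G a" by blast
    then show "openin (top_of_set K) (Collect -` U \<inter> topspace (top_of_set K))"
    proof cases
      case 1
      then have "Collect -` U \<inter> topspace (top_of_set K) = K"
        by (auto simp: K_def precones_avoiding_def)
      then show ?thesis by simp
    next
      case 2
      have "open ((\<lambda>q :: 'a \<Rightarrow> bool. q b) -` B)" for b B
        by (rule open_vimage[OF open_discrete continuous_on_product_coordinates])
      then have "open ((\<lambda>q :: 'a \<Rightarrow> bool. q a) -` {True} \<inter> (\<lambda>q. q (inv a)) -` {False})"
        by (intro open_Int)
      moreover have "Collect -` U \<inter> topspace (top_of_set K) =
          K \<inter> ((\<lambda>q. q a) -` {True} \<inter> (\<lambda>q. q (inv a)) -` {False})"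
        by (auto simp: 2 K_def precone_basic_def precones_avoiding_def)
      ultimately show ?thesis by (simp add: openin_open_Int)
    qed
  qed (auto simp: K_def precones_avoiding_def)
  ultimately have "compactin (precone_space V G) (Collect ` K)"
    by (intro image_compactin[of "top_of_set K"]) (simp_all add: compactin_subtopology)
  moreover have "C \<in> Collect ` K" if "C \<in> precones_avoiding V G F" for C
    using that by (intro image_eqI[of _ _ "\<lambda>x. x \<in> C"]) (simp_all add: K_def)
  then have "Collect ` K = precones_avoiding V G F" by (auto simp: K_def)
  ultimately show ?thesis by simp
qed

text \<open>If \<open>D\<close> omits an element \<open>a\<close> of \<open>C\<close>, then avoiding
  \<open>a\<close> is an open condition separating \<open>D\<close> from \<open>C\<close>.
  Conversely, every basic set that contains \<open>D\<close> contains its smaller pre-cones, because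
  avoiding \<open>F\<close> is inherited by subsets.\<close>

lemma precone_space_closure_of:
  assumes "C \<in> precones V G"
  shows "precone_space V G closure_of {C} = {D \<in> precones V G. C \<subseteq> D}"
proof (intro equalityI subsetI)
  fix D assume D: "D \<in> precone_space V G closure_of {C}"
  then have "D \<in> precones V G" by (simp add: in_closure_of)
  moreover have "a \<in> D" if "a \<in> C" for a
  proof (rule ccontr)
    assume "a \<notin> D"
    have "a \<in> carrier G" using that assms precone_subset by (auto simp: precones_def)
    then have "openin (precone_space V G) (precones_avoiding V G {a})"
      by (simp add: openin_precones_avoiding)
    moreover have "D \<in> precones_avoiding V G {a}"
      using \<open>a \<notin> D\<close> \<open>D \<in> precones V G\<close> by (simp add: precones_avoiding_def)
    ultimately have "C \<in> precones_avoiding V G {a}"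
      using D by (auto simp: in_closure_of)
    with that show False by (simp add: precones_avoiding_def)
  qed
  ultimately show "D \<in> {D \<in> precones V G. C \<subseteq> D}" by blast
next
  fix D assume D: "D \<in> {D \<in> precones V G. C \<subseteq> D}"
  have "C \<in> U" if U: "openin (precone_space V G) U" "D \<in> U" for U
  proof -
    obtain F where "D \<in> precones_avoiding V G F" "precones_avoiding V G F \<subseteq> U"
      using U by (rule precones_avoiding_base)
    then show ?thesis using D assms by (auto simp: precones_avoiding_def)
  qed
  with D show "D \<in> precone_space V G closure_of {C}" by (auto simp: in_closure_of)
qed

text \<open>If every member met \<open>insert a F\<close>, then \<open>S\<close> would be the union
  of its members containing \<open>a\<close> and its members meeting \<open>F\<close>. Both parts
  are closed. The first is proper since \<open>a\<close> is not in the intersection of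
  \<open>S\<close>, the second by the induction hypothesis.\<close>

lemma irreducible_closedin_avoiding:
  assumes S: "irreducible_closedin (precone_space V G) S"
    and F: "finite F" "F \<subseteq> carrier G" "F \<inter> \<Inter>S = {}"
  shows "\<exists>D\<in>S. D \<inter> F = {}"
  using F
proof (induction F rule: finite_induct)
  case empty
  then show ?case using S by (auto simp: irreducible_closedin_def)
next
  case (insert a F)
  let ?X = "precone_space V G"
  have cl: "closedin ?X S" using S by (simp add: irreducible_closedin_def)
  then have SX: "S \<subseteq> precones V G" using closedin_subset by fastforce
  have open_av: "openin ?X (precones_avoiding V G {a})" "openin ?X (precones_avoiding V G F)"
    using insert by (simp_all add: openin_precones_avoiding)
  show ?case
  proof (rule ccontr)
    assume none: "\<not> (\<exists>D\<in>S. D \<inter> insert a F = {})"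
    have "S = (S - precones_avoiding V G {a}) \<union> (S - precones_avoiding V G F)"
      using none by (auto simp: precones_avoiding_def)
    moreover have "closedin ?X (S - precones_avoiding V G {a})" "closedin ?X (S - precones_avoiding V G F)"
      using cl open_av by (simp_all add: closedin_diff)
    moreover have "S - precones_avoiding V G {a} \<subset> S" "S - precones_avoiding V G F \<subset> S"
      using insert SX by (auto simp: precones_avoiding_def)
    ultimately show False using S unfolding irreducible_closedin_def by blast
  qed
qed

text \<open>The generic point is the intersection of all members. Irreducibility makes it a limit of
  members of \<open>S\<close>, so that \<open>precones_limit\<close> applies.\<close>

lemma sober_precone_space:
  assumes V: "l_group_variety V"
  shows "sober_space (precone_space V G)"
  unfolding sober_space_def
proof (intro allI impI)
  fix S assume S: "irreducible_closedin (precone_space V G) S"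
  then have cl: "closedin (precone_space V G) S" and ne: "S \<noteq> {}"
    by (simp_all add: irreducible_closedin_def)
  have SX: "S \<subseteq> precones V G" using closedin_subset[OF cl] by simp
  then have Sub: "D \<subseteq> carrier G" "D \<noteq> carrier G" if "D \<in> S" for D
    using that precone_subset preconeD(3) by (auto simp: precones_def)
  have C: "\<Inter>S \<in> precones V G"
  proof (rule precones_limit[OF V])
    show "\<Inter>S \<noteq> carrier G" using ne Sub by blast
    fix E :: "'a set" assume "finite E"
    \<comment> \<open>Every member contains the elements of \<open>E\<close> in the intersection, so
      \<open>D\<close> only has to avoid the remaining elements of \<open>E\<close> in the group in
      order to agree with the intersection on \<open>E\<close>.\<close>
    then obtain D where D: "D \<in> S" "D \<inter> (E \<inter> carrier G - \<Inter>S) = {}"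
      using irreducible_closedin_avoiding[OF S, of "E \<inter> carrier G - \<Inter>S"] by auto
    then have "\<forall>x\<in>E. x \<in> D \<longleftrightarrow> x \<in> \<Inter>S" using Sub(1)[OF D(1)] by blast
    then show "\<exists>D\<in>precones V G. \<forall>x\<in>E. x \<in> D \<longleftrightarrow> x \<in> \<Inter>S" using D(1) SX by blast
  qed
  have "\<Inter>S \<in> S"
  proof (rule ccontr)
    assume "\<Inter>S \<notin> S"
    moreover have "openin (precone_space V G) (precones V G - S)"
      using cl by (simp add: closedin_def)
    \<comment> \<open>Otherwise a basic neighbourhood of the intersection would miss
      \<open>S\<close>, although some member of \<open>S\<close> avoids the same finite set.\<close>
    ultimately obtain F where F: "finite F" "F \<subseteq> carrier G" "\<Inter>S \<in> precones_avoiding V G F"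
      "precones_avoiding V G F \<subseteq> precones V G - S"
      using precones_avoiding_base[of V "precones V G - S" "\<Inter>S"] C by (metis DiffI)
    then obtain D where "D \<in> S" "D \<inter> F = {}"
      using irreducible_closedin_avoiding[OF S F(1,2)] F(3) by (auto simp: precones_avoiding_def Int_commute)
    then show False using F(4) SX by (auto simp: precones_avoiding_def)
  qed
  then have "precone_space V G closure_of {\<Inter>S} \<subseteq> S"
    using cl by (simp add: closure_of_minimal)
  then have "S = precone_space V G closure_of {\<Inter>S}"
    using SX unfolding precone_space_closure_of[OF C] by blast
  \<comment> \<open>A point whose closure is \<open>S\<close> is the least member of
    \<open>S\<close>, hence equals the intersection.\<close>
  then show "\<exists>!C. C \<in> topspace (precone_space V G) \<and> S = precone_space V G closure_of {C}"
    using C precone_space_closure_of by (intro ex1I[of _ "\<Inter>S"]) auto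
qed

section \<open>Compact open sets and complete normality\<close>

lemma compact_openin_precones_avoiding:
  assumes "l_group_variety V" "finite F" "F \<noteq> {}" "F \<subseteq> carrier G"
  shows "compact_openin (precone_space V G) (precones_avoiding V G F)"
  using assms by (simp add: compact_openin_def compactin_precones_avoiding openin_precones_avoiding)

text \<open>A finite subcover is taken from the cover by basic sets inside \<open>U\<close>, so its
  union is exactly \<open>U\<close>. This normal form reduces intersections of compact open sets to
  those of basic sets.\<close>

lemma compact_openin_precone_spaceE:
  assumes "compact_openin (precone_space V G) U"
  obtains \<F> where "finite \<F>" "\<forall>F\<in>\<F>. finite F \<and> F \<noteq> {} \<and> F \<subseteq> carrier G"
    "U = (\<Union>F\<in>\<F>. precones_avoiding V G F)"
proof -
  define \<A> where "\<A> = {F. finite F \<and> F \<noteq> {} \<and> F \<subseteq> carrier G \<and> precones_avoiding V G F \<subseteq> U}"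
  have U: "compactin (precone_space V G) U" "openin (precone_space V G) U"
    using assms by (simp_all add: compact_openin_def)
  have cover: "U \<subseteq> \<Union>(precones_avoiding V G ` \<A>)"
  proof
    fix C assume "C \<in> U"
    with U(2) obtain F where "finite F" "F \<noteq> {}" "F \<subseteq> carrier G"
      "C \<in> precones_avoiding V G F" "precones_avoiding V G F \<subseteq> U"
      by (rule precones_avoiding_base)
    then show "C \<in> \<Union>(precones_avoiding V G ` \<A>)" by (auto simp: \<A>_def)
  qed
  have "openin (precone_space V G) W" if "W \<in> precones_avoiding V G ` \<A>" for W
    using that openin_precones_avoiding by (auto simp: \<A>_def)
  from compactinD[OF U(1) this cover]
  obtain \<B> where \<B>: "finite \<B>" "\<B> \<subseteq> precones_avoiding V G ` \<A>" "U \<subseteq> \<Union>\<B>"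
    by blast
  then obtain \<F> where "\<F> \<subseteq> \<A>" "finite \<F>" "\<B> = precones_avoiding V G ` \<F>"
    by (meson finite_subset_image)
  then show ?thesis using \<B>(3) by (intro that[of \<F>]) (auto simp: \<A>_def)
qed

lemma generalised_spectral_precone_space:
  assumes V: "l_group_variety V"
  shows "generalised_spectral_space (precone_space V G)"
  unfolding generalised_spectral_space_def
proof (intro conjI allI impI)
  let ?X = "precone_space V G"
  show "sober_space ?X" by (rule sober_precone_space[OF V])
  show "openin ?X = arbitrary union_of compact_openin ?X"
  proof (intro ext iffI)
    fix U assume U: "openin ?X U"
    show "(arbitrary union_of compact_openin ?X) U"
      unfolding arbitrary_union_of_alt
    proof
      fix C assume "C \<in> U"
      with U obtain F where "finite F" "F \<noteq> {}" "F \<subseteq> carrier G"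
        "C \<in> precones_avoiding V G F" "precones_avoiding V G F \<subseteq> U"
        by (rule precones_avoiding_base)
      then show "\<exists>W. compact_openin ?X W \<and> C \<in> W \<and> W \<subseteq> U"
        using compact_openin_precones_avoiding[OF V] by blast
    qed
  next
    fix U assume "(arbitrary union_of compact_openin ?X) U"
    then show "openin ?X U"
      by (auto simp: union_of_def compact_openin_def intro!: openin_Union)
  qed
  fix U W assume "compact_openin ?X U \<and> compact_openin ?X W"
  then have U: "compact_openin ?X U" and W: "compact_openin ?X W" by auto
  obtain \<E> where \<E>: "finite \<E>" "\<forall>E\<in>\<E>. finite E \<and> E \<noteq> {} \<and> E \<subseteq> carrier G"
    "U = (\<Union>E\<in>\<E>. precones_avoiding V G E)"
    using U by (rule compact_openin_precone_spaceE)
  obtain \<F> where \<F>: "finite \<F>" "\<forall>F\<in>\<F>. finite F \<and> F \<noteq> {} \<and> F \<subseteq> carrier G"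
    "W = (\<Union>F\<in>\<F>. precones_avoiding V G F)"
    using W by (rule compact_openin_precone_spaceE)
  \<comment> \<open>Distributing the intersection leaves finitely many basic sets, whose index sets
    \<open>E \<union> F\<close> are nonempty, so that each of them is compact.\<close>
  have "U \<inter> W = \<Union>((\<lambda>(E, F). precones_avoiding V G (E \<union> F)) ` (\<E> \<times> \<F>))"
    by (auto simp: \<E>(3) \<F>(3) precones_avoiding_Un)
  moreover have "compactin ?X \<dots>"
    using \<E>(1,2) \<F>(1,2) by (intro compactin_Union) (auto intro!: compactin_precones_avoiding[OF V])
  ultimately have "compactin ?X (U \<inter> W)" by metis
  then show "compact_openin ?X (U \<inter> W)"
    using U W openin_Int[of ?X U W] by (simp add: compact_openin_def)
qed

text \<open>Take \<open>a\<close> in \<open>C\<close> but not in \<open>D\<close>, and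
  \<open>b\<close> in \<open>D\<close> but not in \<open>C\<close>. By totality \<open>B\<close>
  contains \<open>a \<otimes> inv b\<close> or its inverse. Multiplying by \<open>b\<close> in
  \<open>D\<close> puts \<open>a\<close> into \<open>D\<close>, or multiplying by \<open>a\<close>
  in \<open>C\<close> puts \<open>b\<close> into \<open>C\<close>.\<close>

lemma precone_supersets_comparable:
  assumes B: "precone G B" and C: "precone G C" and D: "precone G D" and "B \<subseteq> C" "B \<subseteq> D"
  shows "C \<subseteq> D \<or> D \<subseteq> C"
proof (rule ccontr)
  assume "\<not> ?thesis"
  then obtain a b where ab: "a \<in> C" "a \<notin> D" "b \<in> D" "b \<notin> C" by blast
  then have car: "a \<in> carrier G" "b \<in> carrier G" using precone_subset C D by blast+
  have "a \<otimes> inv b \<in> B \<or> b \<otimes> inv a \<in> B"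
    using preconeD(4)[OF B, of "a \<otimes> inv b"] car by (simp add: inv_mult_group)
  moreover have "a \<in> D" if "a \<otimes> inv b \<in> B"
    using preconeD(2)[OF D, of "a \<otimes> inv b" b] that \<open>B \<subseteq> D\<close> ab(3) car by (auto simp: m_assoc)
  moreover have "b \<in> C" if "b \<otimes> inv a \<in> B"
    using preconeD(2)[OF C, of "b \<otimes> inv a" a] that \<open>B \<subseteq> C\<close> ab(1) car by (auto simp: m_assoc)
  ultimately show False using ab by blast
qed

end

theorem corollary2p1:
  fixes G :: "'a pogroup" and V :: "('a set \<Rightarrow> 'a set) pogroup set"
  assumes "po_group G" and "l_group_variety V"
  shows "completely_normal_generalised_spectral_space (precone_space V G) \<and>
    (\<forall>C\<in>precones V G. \<forall>D\<in>precones V G. specialises (precone_space V G) C D \<longleftrightarrow> C \<subseteq> D)"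
proof -
  interpret po_group G by fact
  have closure: "D \<in> precone_space V G closure_of {C} \<longleftrightarrow> D \<in> precones V G \<and> C \<subseteq> D"
    if "C \<in> precones V G" for C D
    using precone_space_closure_of[OF that] by simp
  show ?thesis
    unfolding completely_normal_generalised_spectral_space_def
  proof (intro conjI ballI allI impI)
    show "generalised_spectral_space (precone_space V G)"
      by (rule generalised_spectral_precone_space[OF assms(2)])
  next
    fix C D B
    assume *: "B \<in> topspace (precone_space V G) \<and> C \<in> precone_space V G closure_of {B} \<and>
      D \<in> precone_space V G closure_of {B}"
    then have "B \<in> precones V G" by simp
    with * have CD: "C \<in> precones V G" "D \<in> precones V G" "B \<subseteq> C" "B \<subseteq> D"
      by (simp_all add: closure)
    \<comment> \<open>Points in the closure of \<open>B\<close> are pre-cones above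
      \<open>B\<close>; the larger of two comparable ones lies in the closure of the
      smaller.\<close>
    then have "C \<subseteq> D \<or> D \<subseteq> C"
      using \<open>B \<in> precones V G\<close> precone_supersets_comparable[of B C D] by (simp add: precones_def)
    then show "C \<in> precone_space V G closure_of {D} \<or> D \<in> precone_space V G closure_of {C}"
      using CD by (auto simp: closure)
  next
    fix C D assume "C \<in> precones V G" "D \<in> precones V G"
    then show "specialises (precone_space V G) C D \<longleftrightarrow> C \<subseteq> D"
      by (simp add: specialises_def closure)
  qed
qed

end
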